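(* Let $X$ be a nonempty metrizable compactum and $\mathbf{Z}=(|T_j|,g_j^{j+1})$ an induced inverse sequence for $X$ (with $X\subset I^\infty$). For each $j\in\mathbb{N}$ let $M_j\subset|T_j|\subset I^{n_j}$ be a nonempty closed subset such that $g_j^{j+1}(M_{j+1})\subset M_j$. Let $(j_i)$ be an increasing sequence in $\mathbb{N}$, let $\mathbf{M}=(M_{j_i},h_i^{i+1})$ be an adjustment of $\mathbf{Z}$, and let $M=\lim\mathbf{M}$. For $w=(a_1,a_2,\dots)\in M$ put $\pi_i(w)=a_i\in I^\infty$; the sequence $(a_i)$ in $I^\infty$ is called the sequence associated with $w$. Then: (1) for each $w=(a_1,a_2,\dots)\in M$, the sequence $(a_i)$ in $I^\infty$ associated with $w$ is a Cauchy sequence in $I^\infty$ whose limit lies in $X$; (2) the sequence $(\pi_i)$, $\pi_i:M\to I^\infty$, is a Cauchy sequence of maps whose limit $\pi:M\to I^\infty$ is a map having the property that $\pi(M)\subset X$; (3) for each $x\in X$ and $i\in\mathbb{N}$, $B_{x,j_i}\subset B_{x,j_i}^+\subset B_{x,j_i}^\#$, and $h_i^{i+1}(B_{x,j_{i+1}}^\#)\subset B_{x,j_i}$; (4) if for each $x\in X$ we define $\mathbf{M}_x=(B_{x,j_i},h_i^{i+1}|B_{x,j_{i+1}})$, $\mathbf{M}_x^+=(B_{x,j_i}^+,h_i^{i+1}|B_{x,j_{i+1}}^+)$, and $\mathbf{M}_x^\#=(B_{x,j_i}^\#,h_i^{i+1}|B_{x,j_{i+1}}^\#)$, then each of $\mathbf{M}_x$,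 $\mathbf{M}_x^+$, and $\mathbf{M}_x^\#$ is an inverse sequence of metrizable compacta; (5) for all $x\in X$, $\lim\mathbf{M}_x=\lim\mathbf{M}_x^+=\lim\mathbf{M}_x^\#$; (6) for all $x\in X$, $\pi^{-1}(x)=\lim\mathbf{M}_x$; and (7) if for all $i\in\mathbb{N}$, $|T_{j_i}^{(0)}|\subset M_{j_i}$, then $\pi:M\to X$ is surjective.
   Context: A map is a continuous function. For spaces $Y,K$, write $Y\tau K$ if for every closed $A\subset Y$, every map $A\to K$ extends to a map $Y\to K$. Hilbert cube. $I=[0,1]$, $I^\infty=\prod_{i\in\mathbb{N}}I$, with metric $\rho(x,y)=\sum_{i\ge1}|x_i-y_i|/2^i$. A point $x\in I^j$ is identified with $(x,0,0,\dots)\in I^\infty$, so $I^j\subset I^\infty$ and $\rho$ applies to $I^j$. $p_{k,\infty}:I^\infty\to I^k$ and $p_j^k:I^k\to I^j$ ($j\le k$) are the projections to the first $k$, resp. $j$, coordinates. $\overline N(y,r)=\{z:\rho(y,z)\le r\}$. Simplicial notions. $|T|$ is the polyhedron of a simplicial complex $T$ (weak topology) and $T^{(0)}$ its $0$-skeleton (vertex set); $\overline{\mathrm{st}}(v,T)$ is the closed star of a vertex $v$. A triangulation of a compact polyhedron $P$ is a finite simplicial complex $T$ with $|T|=P$; $\operatorname{mesh}T$ is the maximum $\rho$-diameter of its simplexes. For $D\subset|T|$, the simplicial neighborhood of $D$ in $T$ is the subcomplex consisting of all simplexes of $T$ meeting $D$ and all their faces. For functions $f,g:Y\to|T|$, $g$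 is a $T$-modification of $f$ if for each $x\in Y$ and simplex $\sigma$ of $T$ with $f(x)\in\sigma$, one has $g(x)\in\sigma$. A simplicial approximation of a map $f:|S|\to|T|$ is a simplicial map $|S|\to|T|$ that is a $T$-modification of $f$. Fixed countable collections. For each compact metrizable $Y$, $\mathcal{B}(Y)$ is a fixed countable collection of nonempty closed subsets of $Y$ such that for each nonempty closed $C\subset Y$ and each neighborhood $U$ of $C$ there is $A\in\mathcal{B}(Y)$ with $C\subset\operatorname{int}A\subset A\subset U$. For compact metrizable $Y$ and a compact polyhedron $P$, $\mathcal{H}(Y,P)$ is a fixed (countable) set consisting of one map from each homotopy class of maps $Y\to P$. For a nonempty simplicial complex $K$, $\mathcal{F}(K)$ is a fixed countable set of finite simplicial complexes, each simplicially isomorphic to a subcomplex of $K$, such that each finite subcomplex of $K$ is simplicially isomorphic to an element of $\mathcal{F}(K)$. Extension dimension. $\mathcal{C}$ is the class of metrizable compacta, $\mathcal{T}$ the class of CW-complexes. For $K,L\in\mathcal{T}$ put $[K]\le[L]$ if $Y\tau K$ implies $Y\tau L$ for all $Y\in\mathcal{C}$; the extension type $[K]_{(\mathcal{C},\mathcal{T})}$ is the class of $L$ with $[K]\le[L]\le[K]$. $\operatorname{extdim}_{(\mathcal{C},\mathcal{T})}X$ is the least (initial) extension type $[K]$ with $X\tau K$. Thus $[|K|]_{(\mathcal{C},\mathcal{T})}=\operatorname{extdim}_{(\mathcal{C},\mathcal{T})}X$ means $X\tau|K|$ and, whenever $X\tau L$ with $L\in\mathcal{T}$, every $Y\in\mathcal{C}$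 with $Y\tau|K|$ satisfies $Y\tau L$. Induced inverse sequence for a nonempty metrizable compactum $X$. Embed $X$ in $I^\infty$ (and regard $X\subset I^\infty$), let $K$ be a simplicial complex with $[|K|]_{(\mathcal{C},\mathcal{T})}=\operatorname{extdim}_{(\mathcal{C},\mathcal{T})}X$, let $\eta:\mathbb{N}\to\mathbb{N}\times\mathbb{N}$, $\eta(j)=(s_j,t_j)$, be a bijection with $s_j\le j$ for all $j$, and choose a sequence $\mathcal{S}_j=(n_j,P_j,\epsilon_j,\widetilde T_j,f_j^{j+1},\delta_j,T_j,\varphi_j,g_j^{j+1})$, $j\in\mathbb{N}$, where $(n_j)$ is an increasing sequence in $\mathbb{N}$; $P_j\subset I^{n_j}$ is a compact polyhedron and $p_{n_j}^{n_{j+1}}(P_{j+1})\subset P_j$; $\epsilon_j,\delta_j>0$; $\widetilde T_j$ and $T_j$ are triangulations of $P_j$ with $T_j$ a subdivision of $\widetilde T_j$; $f_j^{j+1}:|\widetilde T_{j+1}|\to|T_j|$ is a simplicial approximation of $p_{n_j}^{n_{j+1}}|P_{j+1}:P_{j+1}\to P_j$; $\varphi_j:|T_j|\to|\widetilde T_j|$ is a simplicial approximation of the identity map of $P_j$; $g_j^{j+1}=f_j^{j+1}\circ\varphi_{j+1}:|T_{j+1}|\to|T_j|$, with $g_s^j=g_s^{s+1}\circ\cdots\circ g_{j-1}^j$ for $s<j$ and $g_j^j=\mathrm{id}$; the countable set $\bigcup\{\mathcal{H}(D,|N|)\,|\,(D,N)\in\mathcal{B}(P_j)\times\mathcal{F}(K)\}$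 is indexed as $\{f_{j,k}\,|\,k\in\mathbb{N}\}$, $f_{j,k}:D_{j,k}\to|N_{j,k}|$; and for all $j$: (i) if $j>1$, $u,v\in I^\infty$ and $\rho(u,v)<\epsilon_j$, then $\rho(p_{n_s,\infty}(u),p_{n_s,\infty}(v))<\delta_s$ for all $1\le s<j$; (ii) $5\cdot2^{-n_j}<\epsilon_j$; (iii) $\delta_j<2^{1-n_j}$; (iv) $\operatorname{mesh}T_j<\delta_j/2$; (v) the map $f_{s_j,t_j}\circ g_{s_j}^j|(g_{s_j}^j)^{-1}(D_{s_j,t_j}):(g_{s_j}^j)^{-1}(D_{s_j,t_j})\to|N_{s_j,t_j}|$ extends to a map $\hat f_{s_j,t_j}:|E_{s_j,t_j}|\to|N_{s_j,t_j}|$, where $E_{s_j,t_j}$ is the simplicial neighborhood of $(g_{s_j}^j)^{-1}(D_{s_j,t_j})$ in $T_j$; (vi) $|E^*_{s_j,t_j}|$ is a regular neighborhood of $|E_{s_j,t_j}|$ in $|T_j|$, where $E^*_{s_j,t_j}$ is the simplicial neighborhood of $|E_{s_j,t_j}|$ in $T_j$; (vii) for each $x\in X$ there is $v_{x,j}\in\widetilde T_j^{(0)}$ with $\overline N(p_{n_j,\infty}(x),2\delta_j)\cap P_j\subset\overline{\mathrm{st}}(v_{x,j},\widetilde T_j)\subset\overline N(p_{n_j,\infty}(x),\epsilon_j)\cap P_j$; (viii) if $j>1$ and $1\le s<j$, the simplicial map $g_s^j:|T_j|\to|T_s|$ is a simplicial approximation of $p_{n_s}^{n_j}|P_j:P_j\to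 P_s$. Then $\mathbf{Z}=(|T_j|,g_j^{j+1})$ is called an induced inverse sequence for $X$. Adjustment. Given closed sets $M_j$ as in the claim and an increasing sequence $(j_i)$ in $\mathbb{N}$, an adjustment of $\mathbf{Z}$ is an inverse sequence $\mathbf{M}=(M_{j_i},h_i^{i+1})$ in which each $h_i^{i+1}:M_{j_{i+1}}\to M_{j_i}$ is a map that is a $T_{j_i}$-modification of the restriction $g_{j_i}^{j_{i+1}}|M_{j_{i+1}}:M_{j_{i+1}}\to M_{j_i}$. Sets. With $v_{x,j}$ the vertex of $\widetilde T_j$ from (vii), for $x\in X$ and $j\in\mathbb{N}$: $B_{x,j}=\overline N(p_{n_j,\infty}(x),2\delta_j)\cap M_j$, $B_{x,j}^+=\overline{\mathrm{st}}(v_{x,j},\widetilde T_j)\cap M_j$, $B_{x,j}^\#=\overline N(p_{n_j,\infty}(x),\epsilon_j)\cap M_j$.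
   Formalization: The formal statement adds the hypothesis that every point of the Hilbert cube whose projections lie in all P_j belongs to X; without it, the listed conditions allow X to be one point of a two-point space approximated by the P_j, and then (1) and (2) fail. *)

theory Defs
  imports "HOL-Analysis.Analysis" "HOL-Library.Function_Algebras"
begin

section \<open>The Hilbert cube\<close>

text \<open>
  Points of $I^\infty$ are functions \<^typ>\<open>nat \<Rightarrow> real\<close>; coordinates are numbered from 0, so that
  coordinate \<open>i\<close> has weight $2^{-(i+1)}$ in the metric.  The type-class topology on
  \<^typ>\<open>nat \<Rightarrow> real\<close> is the product topology; the type-class metric differs from \<open>rho\<close>
  and is not used.
\<close>

definition hilbert_cube :: "(nat \<Rightarrow> real) set" where
  "hilbert_cube = {x. \<forall>i. 0 \<le> x i \<and> x i \<le> 1}"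

definition rho :: "(nat \<Rightarrow> real) \<Rightarrow> (nat \<Rightarrow> real) \<Rightarrow> real" where
  "rho x y = (\<Sum>\<^sub>\<infinity>i. \<bar>x i - y i\<bar> / 2 ^ Suc i)"

definition finite_cube :: "nat \<Rightarrow> (nat \<Rightarrow> real) set" where
  "finite_cube n = {x \<in> hilbert_cube. \<forall>i\<ge>n. x i = 0}"

text \<open>
  With $I^k$ identified with \<open>finite_cube k\<close>, both $p_{k,\infty}$ and all the $p_k^m$
  are given by \<open>cube_proj k\<close>.
\<close>

definition cube_proj :: "nat \<Rightarrow> (nat \<Rightarrow> real) \<Rightarrow> (nat \<Rightarrow> real)" where
  "cube_proj k x = (\<lambda>i. if i < k then x i else 0)"

lemma rho_term_le:
  assumes "x \<in> hilbert_cube" "y \<in> hilbert_cube"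
  shows "\<bar>x i - y i\<bar> / 2 ^ Suc i \<le> (1/2) ^ Suc i"
proof -
  have "0 \<le> x i \<and> x i \<le> 1" "0 \<le> y i \<and> y i \<le> 1"
    using assms unfolding hilbert_cube_def by blast+
  then have "\<bar>x i - y i\<bar> \<le> 1"
    by linarith
  then show ?thesis
    by (simp add: power_one_over divide_simps)
qed

lemma rho_summable:
  assumes "x \<in> hilbert_cube" "y \<in> hilbert_cube"
  shows "summable (\<lambda>i. \<bar>x i - y i\<bar> / 2 ^ Suc i)"
proof (rule summable_comparison_test')
  show "summable (\<lambda>i. (1/2::real) ^ Suc i)"
    by (simp add: summable_geometric)
  show "norm (\<bar>x i - y i\<bar> / 2 ^ Suc i) \<le> (1/2) ^ Suc i" for i
    using rho_term_le[OF assms, of i] by simp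
qed

lemma rho_summable_on:
  assumes "x \<in> hilbert_cube" "y \<in> hilbert_cube"
  shows "(\<lambda>i. \<bar>x i - y i\<bar> / 2 ^ Suc i) summable_on UNIV"
  using rho_summable[OF assms] by (intro norm_summable_imp_summable_on) simp

lemma rho_eq_suminf:
  assumes "x \<in> hilbert_cube" "y \<in> hilbert_cube"
  shows "rho x y = (\<Sum>i. \<bar>x i - y i\<bar> / 2 ^ Suc i)"
  unfolding rho_def using rho_summable[OF assms]
  by (intro infsumI norm_summable_imp_has_sum) (auto intro: summable_sums)

lemma rho_ge_term:
  assumes "x \<in> hilbert_cube" "y \<in> hilbert_cube"
  shows "\<bar>x i - y i\<bar> / 2 ^ Suc i \<le> rho x y"
  using sum_le_suminf[OF rho_summable[OF assms], of "{i}"]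
  by (simp add: rho_eq_suminf[OF assms])

interpretation Hilbert: Metric_space hilbert_cube rho
proof
  show "0 \<le> rho x y" for x y
    unfolding rho_def by (intro infsum_nonneg) simp
  show "rho x y = rho y x" for x y
    by (simp add: rho_def abs_minus_commute)
  show "rho x y = 0 \<longleftrightarrow> x = y" if xy: "x \<in> hilbert_cube" "y \<in> hilbert_cube" for x y
  proof
    assume 0: "rho x y = 0"
    have "x i = y i" for i
      using rho_ge_term[OF xy, of i] 0 zero_less_power[of "2::real" "Suc i"]
      by (simp only: divide_le_0_iff) linarith
    then show "x = y" by blast
  qed (simp add: rho_def)
  show "rho x z \<le> rho x y + rho y z"
    if "x \<in> hilbert_cube" "y \<in> hilbert_cube" "z \<in> hilbert_cube" for x y z
  proof -
    have "rho x z \<le> (\<Sum>i. \<bar>x i - y i\<bar> / 2 ^ Suc i + \<bar>y i - z i\<bar> / 2 ^ Suc i)"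
      unfolding rho_eq_suminf[OF that(1,3)]
      by (intro suminf_le rho_summable summable_add that)
        (simp add: divide_right_mono flip: add_divide_distrib)
    also have "\<dots> = rho x y + rho y z"
      unfolding rho_eq_suminf[OF that(1,2)] rho_eq_suminf[OF that(2,3)]
      by (intro suminf_add[symmetric] rho_summable that)
    finally show ?thesis .
  qed
qed

lemma mtopology_rho: "Hilbert.mtopology = top_of_set hilbert_cube"
proof (rule topology_eq[THEN iffD2], intro allI iffI)
  fix U assume U: "openin Hilbert.mtopology U"
  show "openin (top_of_set hilbert_cube) U"
  proof (subst openin_subopen, intro ballI)
    fix x assume x: "x \<in> U"
    then obtain r where r: "r > 0" "Hilbert.mball x r \<subseteq> U"
      using U Hilbert.openin_mtopology by blast
    have xc: "x \<in> hilbert_cube"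
      using U x Hilbert.openin_mtopology by blast
    obtain N where N: "(1/2::real) ^ N < r / 2"
      using real_arch_pow_inv[of "r/2" "1/2"] r by auto
    define V where "V = {y. \<forall>i\<in>{..<N}. \<bar>y i - x i\<bar> < r / 2}"
    have "V = (\<Inter>i\<in>{..<N}. (\<lambda>y. y i) -` ball (x i) (r/2))"
      by (auto simp: V_def dist_real_def abs_minus_commute)
    moreover have "open (\<Inter>i\<in>{..<N}. (\<lambda>y::nat \<Rightarrow> real. y i) -` ball (x i) (r/2))"
      by (intro open_INT ballI open_vimage continuous_on_product_coordinates) auto
    ultimately have "open V" by simp
    moreover have "hilbert_cube \<inter> V \<subseteq> U"
    proof
      fix y assume y: "y \<in> hilbert_cube \<inter> V"
      then have yc: "y \<in> hilbert_cube" by blast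
      let ?f = "\<lambda>i. \<bar>x i - y i\<bar> / 2 ^ Suc i"
      have s: "summable ?f" using rho_summable xc yc by blast
      have geo: "(\<Sum>i. (1/2::real) ^ Suc i) = 1"
        using power_half_series sums_unique by fastforce
      have "(\<Sum>i<N. ?f i) \<le> (\<Sum>i<N. r/2 * (1/2) ^ Suc i)"
        using y by (intro sum_mono)
          (force simp: V_def abs_minus_commute power_one_over divide_simps)
      also have "\<dots> = r/2 * (\<Sum>i<N. (1/2) ^ Suc i)"
        by (rule sum_distrib_left[symmetric])
      also have "(\<Sum>i<N. (1/2::real) ^ Suc i) \<le> (\<Sum>i. (1/2::real) ^ Suc i)"
        by (intro sum_le_suminf) (auto simp: summable_geometric)
      finally have 1: "(\<Sum>i<N. ?f i) \<le> r/2"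
        using r geo by (simp add: mult_left_mono)
      have "(\<Sum>i. ?f (i + N)) \<le> (\<Sum>i. (1/2) ^ N * (1/2) ^ Suc i)"
      proof (intro suminf_le summable_mult)
        show "?f (i + N) \<le> (1/2) ^ N * (1/2) ^ Suc i" for i
          using rho_term_le[OF xc yc, of "i + N"] by (simp add: power_add mult_ac)
        show "summable (\<lambda>i. ?f (i + N))"
          using s by (rule summable_ignore_initial_segment)
        show "summable (\<lambda>i. (1/2::real) ^ Suc i)" by (simp add: summable_geometric)
      qed
      also have "\<dots> = (1/2) ^ N * (\<Sum>i. (1/2) ^ Suc i)"
        by (rule suminf_mult) (simp add: summable_geometric)
      finally have 2: "(\<Sum>i. ?f (i + N)) \<le> (1/2) ^ N" using geo by simp
      have "rho x y < r"
        using suminf_split_initial_segment[OF s, of N] 1 2 N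
        unfolding rho_eq_suminf[OF xc yc] by linarith
      then show "y \<in> U" using r xc yc by auto
    qed
    moreover have "x \<in> V" using r by (simp add: V_def)
    ultimately show "\<exists>T. openin (top_of_set hilbert_cube) T \<and> x \<in> T \<and> T \<subseteq> U"
      using xc by (intro exI[of _ "hilbert_cube \<inter> V"]) (auto simp: openin_open)
  qed
next
  fix U assume U: "openin (top_of_set hilbert_cube) U"
  have "continuous_map Hilbert.mtopology euclidean (\<lambda>x. x)"
  proof -
    have "continuous_map Hilbert.mtopology (powertop_real UNIV) (\<lambda>x i. x i)"
      unfolding continuous_map_componentwise_UNIV
    proof
      fix i
      have "\<forall>x\<in>hilbert_cube. \<forall>e>0. \<exists>d>0. \<forall>y. y \<in> hilbert_cube \<and> rho x y < d \<longrightarrow> dist (x i) (y i) < e"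
      proof (intro ballI allI impI)
        fix x :: "nat \<Rightarrow> real" and e :: real
        assume x: "x \<in> hilbert_cube" and "e > 0"
        show "\<exists>d>0. \<forall>y. y \<in> hilbert_cube \<and> rho x y < d \<longrightarrow> dist (x i) (y i) < e"
        proof (intro exI conjI allI impI)
          show "0 < e / 2 ^ Suc i" using \<open>e > 0\<close> by simp
          fix y assume y: "y \<in> hilbert_cube \<and> rho x y < e / 2 ^ Suc i"
          then have "\<bar>x i - y i\<bar> / 2 ^ Suc i < e / 2 ^ Suc i"
            using rho_ge_term[OF x, of y i] by linarith
          then show "dist (x i) (y i) < e"
            by (simp add: divide_less_cancel dist_real_def)
        qed
      qed
      then show "continuous_map Hilbert.mtopology euclideanreal (\<lambda>x. x i)"
        using Hilbert.metric_continuous_map[OF Met_TC.Metric_space_axioms, of "\<lambda>x. x i"]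
        by simp
    qed
    then show ?thesis
      by (simp add: euclidean_product_topology)
  qed
  moreover obtain V where "open V" "U = hilbert_cube \<inter> V"
    using U openin_open by blast
  ultimately show "openin Hilbert.mtopology U"
    using openin_continuous_map_preimage[of Hilbert.mtopology euclidean "\<lambda>x. x" V]
    by (simp add: Int_def)
qed


section \<open>Simplicial complexes\<close>

instantiation "fun" :: (type, real_vector) real_vector
begin

definition scaleR_fun_def: "scaleR r f = (\<lambda>x. r *\<^sub>R f x)"

instance
  by standard (simp_all add: scaleR_fun_def fun_eq_iff scaleR_add_right scaleR_add_left)

end

text \<open>
  Complexes are geometric complexes in a real vector space \<^typ>\<open>'i \<Rightarrow> real\<close>, not assumed
  finite or locally finite.  A simplex is represented by its vertex set \<open>\<sigma>\<close>, the closed simplex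
  itself being \<open>convex hull \<sigma>\<close>.  Every abstract complex with vertices in \<open>'i\<close> has such a
  realization, and the triangulations of polyhedra in the cubes $I^n$ are literally of this form.
  The empty complex is allowed.
\<close>

definition simplicial_complex :: "('i \<Rightarrow> real) set set \<Rightarrow> bool" where
  "simplicial_complex T \<longleftrightarrow>
     (\<forall>\<sigma>\<in>T. finite \<sigma> \<and> \<sigma> \<noteq> {} \<and> \<not> affine_dependent \<sigma>) \<and>
     (\<forall>\<sigma>\<in>T. \<forall>\<tau>. \<tau> \<subseteq> \<sigma> \<and> \<tau> \<noteq> {} \<longrightarrow> \<tau> \<in> T) \<and>
     (\<forall>\<sigma>\<in>T. \<forall>\<tau>\<in>T. convex hull \<sigma> \<inter> convex hull \<tau> = convex hull (\<sigma> \<inter> \<tau>))"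

definition polyhedron_of :: "('i \<Rightarrow> real) set set \<Rightarrow> ('i \<Rightarrow> real) set" where
  "polyhedron_of T = (\<Union>\<sigma>\<in>T. convex hull \<sigma>)"

definition vertices :: "('i \<Rightarrow> real) set set \<Rightarrow> ('i \<Rightarrow> real) set" where
  "vertices T = {v. {v} \<in> T}"

definition weak_topology :: "('i \<Rightarrow> real) set set \<Rightarrow> ('i \<Rightarrow> real) topology" where
  "weak_topology T = topology (\<lambda>U. U \<subseteq> polyhedron_of T \<and>
     (\<forall>\<sigma>\<in>T. openin (top_of_set (convex hull \<sigma>)) (U \<inter> convex hull \<sigma>)))"

lemma openin_weak_topology:
  "openin (weak_topology T) U \<longleftrightarrow> U \<subseteq> polyhedron_of T \<and>
     (\<forall>\<sigma>\<in>T. openin (top_of_set (convex hull \<sigma>)) (U \<inter> convex hull \<sigma>))"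
proof -
  have "istopology (\<lambda>U. U \<subseteq> polyhedron_of T \<and>
     (\<forall>\<sigma>\<in>T. openin (top_of_set (convex hull \<sigma>)) (U \<inter> convex hull \<sigma>)))"
    unfolding istopology_def
  proof (intro conjI allI impI ballI)
    fix U V \<sigma>
    assume "U \<subseteq> polyhedron_of T \<and>
        (\<forall>\<sigma>\<in>T. openin (top_of_set (convex hull \<sigma>)) (U \<inter> convex hull \<sigma>))"
      and "V \<subseteq> polyhedron_of T \<and>
        (\<forall>\<sigma>\<in>T. openin (top_of_set (convex hull \<sigma>)) (V \<inter> convex hull \<sigma>))"
      and "\<sigma> \<in> T"
    then have "openin (top_of_set (convex hull \<sigma>)) ((U \<inter> convex hull \<sigma>) \<inter> (V \<inter> convex hull \<sigma>))"
      by blast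
    then show "openin (top_of_set (convex hull \<sigma>)) (U \<inter> V \<inter> convex hull \<sigma>)"
      by (simp add: Int_ac)
  next
    fix \<U> \<sigma>
    assume "\<forall>U\<in>\<U>. U \<subseteq> polyhedron_of T \<and>
        (\<forall>\<sigma>\<in>T. openin (top_of_set (convex hull \<sigma>)) (U \<inter> convex hull \<sigma>))" "\<sigma> \<in> T"
    then have "openin (top_of_set (convex hull \<sigma>)) (\<Union>U\<in>\<U>. U \<inter> convex hull \<sigma>)"
      by blast
    then show "openin (top_of_set (convex hull \<sigma>)) (\<Union>\<U> \<inter> convex hull \<sigma>)"
      by (simp add: Int_commute Int_Union)
  qed auto
  then show ?thesis
    by (simp add: weak_topology_def)
qed

definition subcomplex :: "('i \<Rightarrow> real) set set \<Rightarrow> ('i \<Rightarrow> real) set set \<Rightarrow> bool" where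
  "subcomplex L T \<longleftrightarrow> simplicial_complex L \<and> L \<subseteq> T"

definition simplicially_isomorphic ::
    "('i \<Rightarrow> real) set set \<Rightarrow> ('k \<Rightarrow> real) set set \<Rightarrow> bool" where
  "simplicially_isomorphic S T \<longleftrightarrow>
     (\<exists>b. bij_betw b (vertices S) (vertices T) \<and> (\<lambda>\<sigma>. b ` \<sigma>) ` S = T)"

definition triangulation_of ::
    "('i \<Rightarrow> real) set set \<Rightarrow> ('i \<Rightarrow> real) set \<Rightarrow> bool" where
  "triangulation_of T P \<longleftrightarrow> simplicial_complex T \<and> finite T \<and> polyhedron_of T = P"

definition compact_polyhedron :: "('i \<Rightarrow> real) set \<Rightarrow> bool" where
  "compact_polyhedron P \<longleftrightarrow> (\<exists>T. triangulation_of T P)"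

definition subdivision_of ::
    "('i \<Rightarrow> real) set set \<Rightarrow> ('i \<Rightarrow> real) set set \<Rightarrow> bool" where
  "subdivision_of T' T \<longleftrightarrow> simplicial_complex T' \<and> simplicial_complex T \<and>
     polyhedron_of T' = polyhedron_of T \<and>
     (\<forall>\<sigma>\<in>T'. \<exists>\<tau>\<in>T. convex hull \<sigma> \<subseteq> convex hull \<tau>)"

definition closed_star ::
    "('i \<Rightarrow> real) \<Rightarrow> ('i \<Rightarrow> real) set set \<Rightarrow> ('i \<Rightarrow> real) set" where
  "closed_star v T = (\<Union>\<sigma>\<in>{\<sigma>\<in>T. v \<in> \<sigma>}. convex hull \<sigma>)"

definition simplicial_neighborhood ::
    "('i \<Rightarrow> real) set \<Rightarrow> ('i \<Rightarrow> real) set set \<Rightarrow> ('i \<Rightarrow> real) set set" where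
  "simplicial_neighborhood D T =
     {\<tau>\<in>T. \<exists>\<sigma>\<in>T. convex hull \<sigma> \<inter> D \<noteq> {} \<and> \<tau> \<subseteq> \<sigma>}"

definition rho_diameter :: "(nat \<Rightarrow> real) set \<Rightarrow> real" where
  "rho_diameter S = (SUP (x, y)\<in>S \<times> S. rho x y)"

definition mesh :: "(nat \<Rightarrow> real) set set \<Rightarrow> real" where
  "mesh T = Max ((\<lambda>\<sigma>. rho_diameter (convex hull \<sigma>)) ` T)"

definition simplicial_map ::
    "('i \<Rightarrow> real) set set \<Rightarrow> ('k \<Rightarrow> real) set set \<Rightarrow> (('i \<Rightarrow> real) \<Rightarrow> ('k \<Rightarrow> real)) \<Rightarrow> bool" where
  "simplicial_map S T g \<longleftrightarrow>
     (\<forall>\<sigma>\<in>S. g ` \<sigma> \<in> T \<and>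
       (\<forall>c. (\<forall>v\<in>\<sigma>. 0 \<le> c v) \<and> sum c \<sigma> = 1 \<longrightarrow>
          g (\<Sum>v\<in>\<sigma>. c v *\<^sub>R v) = (\<Sum>v\<in>\<sigma>. c v *\<^sub>R g v)))"

definition T_modification ::
    "'y set \<Rightarrow> ('i \<Rightarrow> real) set set \<Rightarrow> ('y \<Rightarrow> 'i \<Rightarrow> real) \<Rightarrow> ('y \<Rightarrow> 'i \<Rightarrow> real) \<Rightarrow> bool" where
  "T_modification Y T f g \<longleftrightarrow>
     f \<in> Y \<rightarrow> polyhedron_of T \<and> g \<in> Y \<rightarrow> polyhedron_of T \<and>
     (\<forall>x\<in>Y. \<forall>\<sigma>\<in>T. f x \<in> convex hull \<sigma> \<longrightarrow> g x \<in> convex hull \<sigma>)"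

definition simplicial_approximation ::
    "('i \<Rightarrow> real) set set \<Rightarrow> ('k \<Rightarrow> real) set set \<Rightarrow>
     (('i \<Rightarrow> real) \<Rightarrow> ('k \<Rightarrow> real)) \<Rightarrow> (('i \<Rightarrow> real) \<Rightarrow> ('k \<Rightarrow> real)) \<Rightarrow> bool" where
  "simplicial_approximation S T f g \<longleftrightarrow>
     simplicial_map S T g \<and> T_modification (polyhedron_of S) T f g"


subsection \<open>Regular neighborhoods\<close>

text \<open>
  A regular neighborhood of \<open>A\<close> in \<open>P\<close> is taken in the sense of Rourke and Sanderson:
  triangulate \<open>(P, A)\<close> by \<open>(J, L)\<close> with \<open>L\<close> full in \<open>J\<close>, let \<open>J'\<close> be a first derived of \<open>J\<close> near
  \<open>L\<close>, i.e. star each mixed simplex (meeting \<open>L\<close> but not in \<open>L\<close>) at an interior point \<open>a \<sigma>\<close>, in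
  order of decreasing dimension; the neighborhood is the polyhedron of the simplicial neighborhood
  of \<open>|L|\<close> in \<open>J'\<close>.  The simplexes of \<open>J'\<close> are spanned by an unmixed face \<open>\<tau>\<close> (possibly empty)
  and the points \<open>a \<sigma>\<close> of a chain of mixed simplexes containing \<open>\<tau>\<close>.
\<close>

definition full_subcomplex :: "('i \<Rightarrow> real) set set \<Rightarrow> ('i \<Rightarrow> real) set set \<Rightarrow> bool" where
  "full_subcomplex L J \<longleftrightarrow> subcomplex L J \<and> (\<forall>\<sigma>\<in>J. \<sigma> \<subseteq> vertices L \<longrightarrow> \<sigma> \<in> L)"

definition open_simplex :: "('i \<Rightarrow> real) set \<Rightarrow> ('i \<Rightarrow> real) set" where
  "open_simplex \<sigma> = convex hull \<sigma> - (\<Union>\<tau>\<in>{\<tau>. \<tau> \<subset> \<sigma>}. convex hull \<tau>)"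

definition mixed_simplexes ::
    "('i \<Rightarrow> real) set set \<Rightarrow> ('i \<Rightarrow> real) set set \<Rightarrow> ('i \<Rightarrow> real) set set" where
  "mixed_simplexes L J = {\<sigma>\<in>J. \<sigma> \<notin> L \<and> convex hull \<sigma> \<inter> polyhedron_of L \<noteq> {}}"

definition derived_near ::
    "(('i \<Rightarrow> real) set \<Rightarrow> 'i \<Rightarrow> real) \<Rightarrow> ('i \<Rightarrow> real) set set \<Rightarrow> ('i \<Rightarrow> real) set set \<Rightarrow>
     ('i \<Rightarrow> real) set set" where
  "derived_near a L J =
     {\<tau> \<union> a ` C | \<tau> C.
        (\<tau> = {} \<or> \<tau> \<in> J - mixed_simplexes L J) \<and>
        C \<subseteq> mixed_simplexes L J \<and>
        (\<forall>\<sigma>\<in>C. \<forall>\<sigma>'\<in>C. \<sigma> \<subseteq> \<sigma>' \<or> \<sigma>' \<subseteq> \<sigma>) \<and>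
        (\<forall>\<sigma>\<in>C. \<tau> \<subseteq> \<sigma>) \<and>
        \<tau> \<union> a ` C \<noteq> {}}"

definition regular_neighborhood ::
    "('i \<Rightarrow> real) set \<Rightarrow> ('i \<Rightarrow> real) set \<Rightarrow> ('i \<Rightarrow> real) set \<Rightarrow> bool" where
  "regular_neighborhood N A P \<longleftrightarrow>
     (\<exists>J L a. triangulation_of J P \<and> full_subcomplex L J \<and> polyhedron_of L = A \<and>
        (\<forall>\<sigma>\<in>mixed_simplexes L J. a \<sigma> \<in> open_simplex \<sigma>) \<and>
        N = polyhedron_of (simplicial_neighborhood (polyhedron_of L) (derived_near a L J)))"


section \<open>Extension dimension\<close>

definition metrizable_compactum :: "'y topology \<Rightarrow> bool" where
  "metrizable_compactum Y \<longleftrightarrow> compact_space Y \<and> metrizable_space Y"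

text \<open>The relation $Y\tau K$:\<close>

definition absolute_coextensor :: "'y topology \<Rightarrow> 'k topology \<Rightarrow> bool" where
  "absolute_coextensor Y K \<longleftrightarrow>
     (\<forall>A f. closedin Y A \<and> continuous_map (subtopology Y A) K f \<longrightarrow>
        (\<exists>g. continuous_map Y K g \<and> (\<forall>x\<in>A. g x = f x)))"

definition closed_ball_space :: "nat \<Rightarrow> (nat \<Rightarrow> real) topology" where
  "closed_ball_space n = subtopology (Euclidean_space n) {x. (\<Sum>i<n. (x i)\<^sup>2) \<le> 1}"

text \<open>
  A CW-complex is given by its cells \<open>(n, e)\<close>, where \<open>n\<close> is the dimension and \<open>e\<close> the open cell.
\<close>

definition cw_decomposition :: "'a topology \<Rightarrow> (nat \<times> 'a set) set \<Rightarrow> bool" where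
  "cw_decomposition L \<E> \<longleftrightarrow>
     \<Union>(snd ` \<E>) = topspace L \<and>
     (\<forall>c\<in>\<E>. \<forall>d\<in>\<E>. c \<noteq> d \<longrightarrow> snd c \<inter> snd d = {}) \<and>
     (\<forall>(n, e)\<in>\<E>. \<exists>\<Phi>.
        continuous_map (closed_ball_space n) L \<Phi> \<and>
        homeomorphic_map (subtopology (closed_ball_space n) {x. (\<Sum>i<n. (x i)\<^sup>2) < 1})
          (subtopology L e) \<Phi> \<and>
        (\<exists>\<F>\<subseteq>\<E>. finite \<F> \<and> (\<forall>(m, d)\<in>\<F>. m < n) \<and>
           \<Phi> ` {x \<in> topspace (closed_ball_space n). (\<Sum>i<n. (x i)\<^sup>2) = 1} \<subseteq> \<Union>(snd ` \<F>))) \<and>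
     (\<forall>A\<subseteq>topspace L. (\<forall>(n, e)\<in>\<E>. closedin L (A \<inter> L closure_of e)) \<longrightarrow> closedin L A)"

definition cw_complex :: "'a topology \<Rightarrow> bool" where
  "cw_complex L \<longleftrightarrow> Hausdorff_space L \<and> (\<exists>\<E>. cw_decomposition L \<E>)"

text \<open>
  The two classes of spaces are represented on the type \<^typ>\<open>nat \<Rightarrow> real\<close>.  Every metrizable
  compactum is homeomorphic to a subspace of the Hilbert cube.  For every CW-complex \<open>L\<close> there is a
  subcomplex with at most continuum many cells, hence homeomorphic to a space on
  \<^typ>\<open>nat \<Rightarrow> real\<close>, that is a coextensor for the same metrizable compacta: start with finite
  subcomplexes carrying one non-extendable map for each compactum in the Hilbert cube for which \<open>L\<close>
  is not a coextensor, and adjoin countably often finite carriers of extensions of all extendable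
  maps from closed subsets into finite subcomplexes of what has been obtained so far.  So no
  generality is lost compared with quantifying over all spaces.
\<close>

definition ext_type_le :: "'k topology \<Rightarrow> 'l topology \<Rightarrow> bool" where
  "ext_type_le K L \<longleftrightarrow>
     (\<forall>Y :: (nat \<Rightarrow> real) topology.
        metrizable_compactum Y \<and> absolute_coextensor Y K \<longrightarrow> absolute_coextensor Y L)"

definition is_extension_dimension :: "'k topology \<Rightarrow> 'x topology \<Rightarrow> bool" where
  "is_extension_dimension K X \<longleftrightarrow> absolute_coextensor X K \<and>
     (\<forall>L :: (nat \<Rightarrow> real) topology.
        cw_complex L \<and> absolute_coextensor X L \<longrightarrow> ext_type_le K L)"


section \<open>The fixed countable collections\<close>

abbreviation is_map :: "'a::topological_space set \<Rightarrow> 'b::topological_space set \<Rightarrow> ('a \<Rightarrow> 'b) \<Rightarrow> bool"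
  where "is_map Y Z f \<equiv> continuous_on Y f \<and> f \<in> Y \<rightarrow> Z"

text \<open>
  The metrizable compacta to which \<open>\<B>\<close> and \<open>\<H>\<close> are applied are compact subsets of
  \<^typ>\<open>nat \<Rightarrow> real\<close>.  On the polyhedron of a finite complex the weak topology is the subspace
  topology.
\<close>

definition fixed_closed_sets :: "((nat \<Rightarrow> real) set \<Rightarrow> (nat \<Rightarrow> real) set set) \<Rightarrow> bool" where
  "fixed_closed_sets \<B> \<longleftrightarrow>
     (\<forall>Y. compact Y \<longrightarrow>
        countable (\<B> Y) \<and>
        (\<forall>A\<in>\<B> Y. A \<noteq> {} \<and> closedin (top_of_set Y) A) \<and>
        (\<forall>C U. C \<noteq> {} \<and> closedin (top_of_set Y) C \<and> U \<subseteq> Y \<and>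
           C \<subseteq> top_of_set Y interior_of U \<longrightarrow>
           (\<exists>A\<in>\<B> Y. C \<subseteq> top_of_set Y interior_of A \<and> A \<subseteq> U)))"

definition fixed_homotopy_reps ::
    "((nat \<Rightarrow> real) set \<Rightarrow> ('u \<Rightarrow> real) set \<Rightarrow> ((nat \<Rightarrow> real) \<Rightarrow> ('u \<Rightarrow> real)) set) \<Rightarrow> bool" where
  "fixed_homotopy_reps \<H> \<longleftrightarrow>
     (\<forall>Y P. compact Y \<and> compact_polyhedron P \<longrightarrow>
        countable (\<H> Y P) \<and>
        (\<forall>h\<in>\<H> Y P. is_map Y P h) \<and>
        (\<forall>f. is_map Y P f \<longrightarrow>
           (\<exists>!h. h \<in> \<H> Y P \<and> homotopic_with_canon (\<lambda>_. True) Y P f h)))"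

definition fixed_finite_complexes ::
    "('k \<Rightarrow> real) set set \<Rightarrow> ('u \<Rightarrow> real) set set set \<Rightarrow> bool" where
  "fixed_finite_complexes K \<F> \<longleftrightarrow>
     countable \<F> \<and>
     (\<forall>N\<in>\<F>. simplicial_complex N \<and> finite N \<and>
        (\<exists>L. subcomplex L K \<and> simplicially_isomorphic N L)) \<and>
     (\<forall>L. subcomplex L K \<and> finite L \<longrightarrow> (\<exists>N\<in>\<F>. simplicially_isomorphic L N))"


section \<open>Inverse sequences\<close>

text \<open>
  For bonding maps \<open>g j\<close> from stage \<open>j + 1\<close> to stage \<open>j\<close>, \<open>bonding g s j\<close> is
  \<open>g s \<circ> \<dots> \<circ> g (j - 1)\<close> if \<open>s < j\<close>, and the identity if \<open>s = j\<close>.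
\<close>

primrec bonding :: "(nat \<Rightarrow> 'a \<Rightarrow> 'a) \<Rightarrow> nat \<Rightarrow> nat \<Rightarrow> 'a \<Rightarrow> 'a" where
  "bonding g s 0 = id"
| "bonding g s (Suc j) = (if s \<le> j then bonding g s j \<circ> g j else id)"

definition inverse_sequence_of_compacta ::
    "(nat \<Rightarrow> 'a::topological_space set) \<Rightarrow> (nat \<Rightarrow> 'a \<Rightarrow> 'a) \<Rightarrow> bool" where
  "inverse_sequence_of_compacta A h \<longleftrightarrow>
     (\<forall>i. metrizable_compactum (top_of_set (A i)) \<and> is_map (A (Suc i)) (A i) (h i))"

definition inverse_limit :: "(nat \<Rightarrow> 'a set) \<Rightarrow> (nat \<Rightarrow> 'a \<Rightarrow> 'a) \<Rightarrow> (nat \<Rightarrow> 'a) set" where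
  "inverse_limit A h = {w. \<forall>i. w i \<in> A i \<and> h i (w (Suc i)) = w i}"

text \<open>
  Indices \<open>j\<close>, as well as the two components of \<open>\<eta> j\<close>, are numbered from 0; the dimensions \<open>n j\<close>
  are actual positive integers.  \<open>T'\<close> is the triangulation $\widetilde T$, \<open>f j\<close> is $f_j^{j+1}$,
  \<open>g j\<close> is $g_j^{j+1}$, and \<open>F j k : D j k \<rightarrow> |N j k|\<close> is the enumeration $f_{j,k}$.
  The function \<open>v\<close> is a choice of the vertices $v_{x,j}$.

  The assumption \<open>X_exhausts\<close> records that the polyhedra \<open>P j\<close> approximate \<open>X\<close>; in the construction
  of such sequences \<open>X\<close> is the intersection of the sets $p_{n_j,\infty}^{-1}(P_j)$, and only the
  nontrivial inclusion is required.  It does not follow from the other assumptions: these involve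
  \<open>X\<close> only through its extension dimension and the choice of \<open>v\<close>, so a sequence for \<open>X\<close> would also
  be one for every nonempty closed subset of \<open>X\<close> of the same extension dimension (e.g. for one point
  of a two-point space), although the points of the limit of the sequence \<open>(|T j|, g j)\<close> are
  mapped onto all of \<open>X\<close>.
\<close>

locale induced_inverse_sequence =
  fixes X :: "(nat \<Rightarrow> real) set"
    and K :: "('k \<Rightarrow> real) set set"
    and \<B> :: "(nat \<Rightarrow> real) set \<Rightarrow> (nat \<Rightarrow> real) set set"
    and \<H> :: "(nat \<Rightarrow> real) set \<Rightarrow> ('u \<Rightarrow> real) set \<Rightarrow> ((nat \<Rightarrow> real) \<Rightarrow> ('u \<Rightarrow> real)) set"
    and \<F> :: "('u \<Rightarrow> real) set set set"
    and \<eta> :: "nat \<Rightarrow> nat \<times> nat"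
    and n :: "nat \<Rightarrow> nat"
    and P :: "nat \<Rightarrow> (nat \<Rightarrow> real) set"
    and \<epsilon> :: "nat \<Rightarrow> real"
    and T' :: "nat \<Rightarrow> (nat \<Rightarrow> real) set set"
    and f :: "nat \<Rightarrow> (nat \<Rightarrow> real) \<Rightarrow> (nat \<Rightarrow> real)"
    and \<delta> :: "nat \<Rightarrow> real"
    and T :: "nat \<Rightarrow> (nat \<Rightarrow> real) set set"
    and \<phi> :: "nat \<Rightarrow> (nat \<Rightarrow> real) \<Rightarrow> (nat \<Rightarrow> real)"
    and g :: "nat \<Rightarrow> (nat \<Rightarrow> real) \<Rightarrow> (nat \<Rightarrow> real)"
    and D :: "nat \<Rightarrow> nat \<Rightarrow> (nat \<Rightarrow> real) set"
    and N :: "nat \<Rightarrow> nat \<Rightarrow> ('u \<Rightarrow> real) set set"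
    and F :: "nat \<Rightarrow> nat \<Rightarrow> (nat \<Rightarrow> real) \<Rightarrow> ('u \<Rightarrow> real)"
    and v :: "(nat \<Rightarrow> real) \<Rightarrow> nat \<Rightarrow> (nat \<Rightarrow> real)"
  assumes X: "X \<noteq> {}" "compact X" "X \<subseteq> hilbert_cube"
    and K: "simplicial_complex K" "K \<noteq> {}"
    and extdim: "is_extension_dimension (weak_topology K) (top_of_set X)"
    and collections: "fixed_closed_sets \<B>" "fixed_homotopy_reps \<H>" "fixed_finite_complexes K \<F>"
    and eta: "bij \<eta>" "\<And>j. fst (\<eta> j) \<le> j"
    and n: "strict_mono n" "\<And>j. n j \<ge> 1"
    and P: "\<And>j. compact_polyhedron (P j)" "\<And>j. P j \<subseteq> finite_cube (n j)"
      "\<And>j. cube_proj (n j) ` P (Suc j) \<subseteq> P j"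
    and X_exhausts: "(\<Inter>j. {u \<in> hilbert_cube. cube_proj (n j) u \<in> P j}) \<subseteq> X"
    and pos: "\<And>j. \<epsilon> j > 0" "\<And>j. \<delta> j > 0"
    and triangulations: "\<And>j. triangulation_of (T' j) (P j)" "\<And>j. triangulation_of (T j) (P j)"
      "\<And>j. subdivision_of (T j) (T' j)"
    and f: "\<And>j. simplicial_approximation (T' (Suc j)) (T j) (cube_proj (n j)) (f j)"
    and \<phi>: "\<And>j. simplicial_approximation (T j) (T' j) id (\<phi> j)"
    and g: "\<And>j x. x \<in> polyhedron_of (T (Suc j)) \<Longrightarrow> g j x = f j (\<phi> (Suc j) x)"
    and enum_mem: "\<And>j k. D j k \<in> \<B> (P j) \<and> N j k \<in> \<F> \<and> F j k \<in> \<H> (D j k) (polyhedron_of (N j k))"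
    and enum_onto: "\<And>j D\<^sub>0 N\<^sub>0 h. \<lbrakk>D\<^sub>0 \<in> \<B> (P j); N\<^sub>0 \<in> \<F>; h \<in> \<H> D\<^sub>0 (polyhedron_of N\<^sub>0)\<rbrakk> \<Longrightarrow>
      \<exists>k. D j k = D\<^sub>0 \<and> polyhedron_of (N j k) = polyhedron_of N\<^sub>0 \<and> F j k = h"
    and i: "\<And>j s u w. \<lbrakk>s < j; u \<in> hilbert_cube; w \<in> hilbert_cube; rho u w < \<epsilon> j\<rbrakk> \<Longrightarrow>
      rho (cube_proj (n s) u) (cube_proj (n s) w) < \<delta> s"
    and ii: "\<And>j. 5 / 2 ^ n j < \<epsilon> j"
    and iii: "\<And>j. \<delta> j < 2 / 2 ^ n j"
    and iv: "\<And>j. mesh (T j) < \<delta> j / 2"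
    and v: "\<And>j s t C E. \<lbrakk>\<eta> j = (s, t); C = bonding g s j -` D s t \<inter> polyhedron_of (T j);
        E = simplicial_neighborhood C (T j)\<rbrakk> \<Longrightarrow>
      \<exists>F'. is_map (polyhedron_of E) (polyhedron_of (N s t)) F' \<and>
        (\<forall>x\<in>C. F' x = F s t (bonding g s j x))"
    and vi: "\<And>j s t C E. \<lbrakk>\<eta> j = (s, t); C = bonding g s j -` D s t \<inter> polyhedron_of (T j);
        E = simplicial_neighborhood C (T j)\<rbrakk> \<Longrightarrow>
      regular_neighborhood (polyhedron_of (simplicial_neighborhood (polyhedron_of E) (T j)))
        (polyhedron_of E) (polyhedron_of (T j))"
    and vii: "\<And>x j. x \<in> X \<Longrightarrow> v x j \<in> vertices (T' j) \<and>
      Hilbert.mcball (cube_proj (n j) x) (2 * \<delta> j) \<inter> P j \<subseteq> closed_star (v x j) (T' j) \<and>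
      closed_star (v x j) (T' j) \<subseteq> Hilbert.mcball (cube_proj (n j) x) (\<epsilon> j) \<inter> P j"
    and viii: "\<And>j s. s < j \<Longrightarrow>
      simplicial_approximation (T j) (T s) (cube_proj (n s)) (bonding g s j)"

definition adjustment ::
    "(nat \<Rightarrow> (nat \<Rightarrow> real) set set) \<Rightarrow> (nat \<Rightarrow> (nat \<Rightarrow> real) \<Rightarrow> (nat \<Rightarrow> real)) \<Rightarrow>
     (nat \<Rightarrow> (nat \<Rightarrow> real) set) \<Rightarrow> (nat \<Rightarrow> nat) \<Rightarrow> (nat \<Rightarrow> (nat \<Rightarrow> real) \<Rightarrow> (nat \<Rightarrow> real)) \<Rightarrow> bool" where
  "adjustment T g M J h \<longleftrightarrow>
     (\<forall>i. is_map (M (J (Suc i))) (M (J i)) (h i) \<and>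
        T_modification (M (J (Suc i))) (T (J i)) (bonding g (J i) (J (Suc i))) (h i))"

definition B_set where
  "B_set n \<delta> M x j = Hilbert.mcball (cube_proj (n j) x) (2 * \<delta> j) \<inter> M j"

definition B_plus where
  "B_plus v T' M x j = closed_star (v x j) (T' j) \<inter> M j"

definition B_sharp where
  "B_sharp n \<epsilon> M x j = Hilbert.mcball (cube_proj (n j) x) (\<epsilon> j) \<inter> M j"

definition limit_point_of :: "(nat \<Rightarrow> nat \<Rightarrow> real) \<Rightarrow> (nat \<Rightarrow> real)" where
  "limit_point_of w = (THE a. limitin Hilbert.mtopology w a sequentially)"

end

theory Submission
  imports Defs
begin

text \<open>
  Write $p_j$ for the projection to the first $n_j$ coordinates.  As the simplexes of \<open>T j\<close> are
  smaller than \<open>\<delta> j / 2\<close> and both $g_j^{j'}$ and its modification $h$ only move points within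
  simplexes, $h$ is \<open>\<delta> j\<close>-close to $p_j$, which moves points by at most $2^{-n_j}$.  So
  consecutive terms of a thread are within $3 \cdot 2^{-n_j}$, and threads converge uniformly, with
  error at most $6 \cdot 2^{-n_j}$ at stage $j$; the limit projects into every \<open>P j\<close> and so lies
  in \<open>X\<close>.  By (i), $p_j$ maps the \<open>\<epsilon>\<close>-ball about a projection of $x$ at a later stage into the
  \<open>\<delta> j\<close>-ball about $p_j(x)$, and $h$ then maps it into the ball of radius \<open>2 * \<delta> j\<close>; hence the
  three inverse sequences at $x$ are interleaved and have the same limit, which the error estimate
  identifies with the fibre over $x$.  If all vertices of \<open>T j\<close> belong to \<open>M j\<close>, the stages are
  nonempty compacta, so the fibre is nonempty.
\<close>

section \<open>Compactness of hulls and nonempty inverse limits\<close>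

lemma compact_Pi_UNIV:
  fixes A :: "'i \<Rightarrow> 'b::topological_space set"
  assumes "\<And>i. compact (A i)"
  shows "compact (Pi UNIV A)"
proof -
  have "compactin (product_topology (\<lambda>i::'i. euclidean) UNIV) (PiE UNIV A)"
    using assms by (simp add: compactin_PiE)
  then show ?thesis
    by (simp add: euclidean_product_topology PiE_UNIV_domain)
qed

text \<open>Induction on the vertices: for nonempty \<open>S\<close> the hull of
  \<open>insert a S\<close> is the image of the compact set
  \<open>{0..1} \<times> (convex hull S)\<close> under
  \<open>(t, x) \<mapsto> (1 - t) a + t x\<close>, whose continuity is checked
  coordinatewise.\<close>

lemma compact_convex_hull_finite:
  fixes S :: "(nat \<Rightarrow> real) set"
  assumes "finite S"
  shows "compact (convex hull S)"
  using assms
proof induction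
  case (insert a S)
  have "continuous_on A (\<lambda>p::real \<times> (nat \<Rightarrow> real). (1 - fst p) *\<^sub>R a + fst p *\<^sub>R snd p)" for A
  proof (rule continuous_on_coordinatewise_then_product)
    fix i
    have "continuous_on A (\<lambda>p::real \<times> (nat \<Rightarrow> real). snd p i)"
      by (rule continuous_on_product_then_coordinatewise[OF continuous_on_snd[OF continuous_on_id]])
    then have "continuous_on A (\<lambda>p. (1 - fst p) * a i + fst p * snd p i)"
      by (intro continuous_on_add continuous_on_mult continuous_on_diff continuous_on_fst
          continuous_on_const continuous_on_id)
    then show "continuous_on A (\<lambda>p. ((1 - fst p) *\<^sub>R a + fst p *\<^sub>R snd p) i)"
      by (simp add: scaleR_fun_def)
  qed
  moreover have "compact ({0..1::real} \<times> (convex hull S))"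
    using insert by (intro compact_Times) auto
  ultimately have "compact ((\<lambda>p. (1 - fst p) *\<^sub>R a + fst p *\<^sub>R snd p) ` ({0..1} \<times> (convex hull S)))"
    using compact_continuous_image by blast
  moreover have "\<dots> = {(1 - u) *\<^sub>R a + u *\<^sub>R x |x u. 0 \<le> u \<and> u \<le> 1 \<and> x \<in> convex hull S}"
    by (force simp: image_iff)
  ultimately show ?case
    by (auto simp: convex_hull_insert_alt)
qed simp

lemma compact_polyhedron_of:
  fixes T :: "(nat \<Rightarrow> real) set set"
  assumes "simplicial_complex T" "finite T"
  shows "compact (polyhedron_of T)"
  using assms unfolding polyhedron_of_def simplicial_complex_def
  by (intro compact_UN) (auto intro: compact_convex_hull_finite)

lemma compact_closed_star:
  fixes T :: "(nat \<Rightarrow> real) set set"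
  assumes "simplicial_complex T" "finite T"
  shows "compact (closed_star u T)"
  using assms unfolding closed_star_def simplicial_complex_def
  by (intro compact_UN) (auto intro: compact_convex_hull_finite)

text \<open>For each \<open>m\<close> there is a point of the product satisfying the first
  \<open>m\<close> thread equations. By sequential compactness of the product a subsequence of these
  points converges, and continuity of the bonding maps passes every equation to the limit.\<close>

lemma inverse_limit_nonempty:
  fixes A :: "nat \<Rightarrow> 'a::metric_space set"
  assumes compact: "\<And>i. compact (A i)" and nonempty: "\<And>i. A i \<noteq> {}"
    and h: "\<And>i. is_map (A (Suc i)) (A i) (h i)"
  shows "inverse_limit A h \<noteq> {}"
proof -
  have partial_thread: "\<exists>w\<in>Pi UNIV A. \<forall>i<m. h i (w (Suc i)) = w i" for m
  proof -
    obtain c where c: "\<And>i. c i \<in> A i" 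
      using that[of "\<lambda>i. SOME x. x \<in> A i"] nonempty by (simp add: some_in_eq)
    \<comment> \<open>Up to stage \<open>m\<close> the point \<open>c m\<close> is pushed down;
      beyond \<open>m\<close> no equation is required and any points of the stages serve.\<close>
    define w where "w i = (if i \<le> m then bonding h i m (c m) else c i)" for i
    have refl: "bonding h i i = id" for i by (cases i) auto
    \<comment> \<open>\<open>bonding\<close> recurses at its upper index; thread equations need the
      lowest map split off instead.\<close>
    have step: "bonding h i k = h i \<circ> bonding h (Suc i) k" if "i < k" for i k
      using that
    proof (induction k)
      case (Suc k)
      then show ?case by (cases "i = k") (simp_all add: refl o_assoc)
    qed simp
    \<comment> \<open>Membership is inherited downwards from stage \<open>m\<close>, hence the
      induction on the distance \<open>d\<close> from \<open>m\<close>.\<close>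
    have mem: "bonding h (m - d) m (c m) \<in> A (m - d)" if "d \<le> m" for d
      using that
    proof (induction d)
      case 0 show ?case using c refl by simp
    next
      case (Suc d)
      then have "Suc (m - Suc d) = m - d" "m - Suc d < m" by auto
      with step[of "m - Suc d" m]
      have "bonding h (m - Suc d) m (c m) = h (m - Suc d) (bonding h (m - d) m (c m))"
        by (simp only: o_apply)
      moreover have "bonding h (m - d) m (c m) \<in> A (Suc (m - Suc d))"
        using Suc.IH Suc.prems \<open>Suc (m - Suc d) = m - d\<close> by simp
      ultimately show ?case using h[of "m - Suc d"] by (metis PiE)
    qed
    have "w i \<in> A i" for i
    proof (cases "i \<le> m")
      case True
      with mem[of "m - i"] show ?thesis by (simp add: w_def)
    qed (simp add: w_def c)
    moreover have "h i (w (Suc i)) = w i" if "i < m" for i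
    proof -
      have "w i = bonding h i m (c m)" "w (Suc i) = bonding h (Suc i) m (c m)"
        using that by (simp_all add: w_def)
      then show ?thesis using step[OF that] by (simp only: o_apply)
    qed
    ultimately show ?thesis by (intro bexI[of _ w]) auto
  qed
  then have "\<forall>m. \<exists>w. w \<in> Pi UNIV A \<and> (\<forall>i<m. h i (w (Suc i)) = w i)"
    by blast
  then obtain W where "\<forall>m. W m \<in> Pi UNIV A \<and> (\<forall>i<m. h i (W m (Suc i)) = W m i)"
    by (rule choice[THEN exE])
  then have W: "\<And>m. W m \<in> Pi UNIV A" "\<And>m i. i < m \<Longrightarrow> h i (W m (Suc i)) = W m i"
    by blast+
  obtain w r where w: "w \<in> Pi UNIV A" and r: "strict_mono r" and lim: "(W \<circ> r) \<longlonglongrightarrow> w"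
    using seq_compactE[of "Pi UNIV A" W] compact_Pi_UNIV[of A, OF compact] W(1)
    unfolding compact_eq_seq_compact_metric by blast
  have coord: "(\<lambda>m. W (r m) i) \<longlonglongrightarrow> w i" for i
    using continuous_on_tendsto_compose[OF continuous_on_product_coordinates lim, of i]
    by (simp add: o_def)
  have "h i (w (Suc i)) = w i" for i
  proof -
    have "(\<lambda>m. h i (W (r m) (Suc i))) \<longlonglongrightarrow> h i (w (Suc i))"
    proof (rule continuous_on_tendsto_compose[OF _ coord])
      show "continuous_on (A (Suc i)) (h i)" using h[of i] by blast
    qed (use w W(1) in \<open>auto simp: Pi_iff\<close>)
    \<comment> \<open>Since \<open>r m \<ge> m\<close>, the equation at stage \<open>i\<close> holds
      exactly for all \<open>m > i\<close>, so both sides have the same limit.\<close>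
    moreover have "\<forall>\<^sub>F m in sequentially. h i (W (r m) (Suc i)) = W (r m) i"
    proof (rule eventually_mono[OF eventually_gt_at_top[of i]])
      show "h i (W (r m) (Suc i)) = W (r m) i" if "i < m" for m
        using W(2) that seq_suble[OF r, of m] by simp
    qed
    ultimately have "(\<lambda>m. W (r m) i) \<longlonglongrightarrow> h i (w (Suc i))"
      by (rule Lim_transform_eventually)
    then show ?thesis using coord by (rule LIMSEQ_unique)
  qed
  with w show ?thesis by (auto simp: inverse_limit_def Pi_iff)
qed

section \<open>The metric of the Hilbert cube and its projections\<close>

lemma compact_hilbert_cube: "compact hilbert_cube"
proof -
  have "hilbert_cube = Pi UNIV (\<lambda>_. {0..1})"
    by (auto simp: hilbert_cube_def)
  then show ?thesis
    using compact_Pi_UNIV[of "\<lambda>_::nat. {0..1::real}"] by simp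
qed

lemma closed_Hilbert_mcball: "closed (Hilbert.mcball x r)"
  using Hilbert.closedin_mcball[of x r] compact_imp_closed[OF compact_hilbert_cube]
  unfolding mtopology_rho by (rule closedin_closed_trans)

text \<open>As \<open>rho\<close> induces the subspace topology, results on type-class limits and
  closed sets apply to \<open>rho\<close>-limits.\<close>

lemma limitin_rho_iff:
  "limitin Hilbert.mtopology y a sequentially \<longleftrightarrow>
     a \<in> hilbert_cube \<and> (\<forall>\<^sub>F i in sequentially. y i \<in> hilbert_cube) \<and> y \<longlonglongrightarrow> a"
  by (auto simp: mtopology_rho limitin_subtopology)

lemma finite_cube_subset: "finite_cube k \<subseteq> hilbert_cube"
  by (auto simp: finite_cube_def)

lemma cube_proj_mem: "x \<in> hilbert_cube \<Longrightarrow> cube_proj k x \<in> hilbert_cube"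
  by (auto simp: hilbert_cube_def cube_proj_def)

lemma cube_proj_cube_proj: "k \<le> m \<Longrightarrow> cube_proj k (cube_proj m x) = cube_proj k x"
  by (auto simp: cube_proj_def)

lemma continuous_on_cube_proj: "continuous_on S (cube_proj k)"
proof (rule continuous_on_coordinatewise_then_product)
  show "continuous_on S (\<lambda>x. cube_proj k x i)" for i
    by (cases "i < k")
      (auto simp: cube_proj_def intro: continuous_on_product_then_coordinatewise[OF continuous_on_id])
qed

lemma rho_cube_proj_le:
  assumes "x \<in> hilbert_cube" "y \<in> hilbert_cube"
  shows "rho (cube_proj k x) (cube_proj k y) \<le> rho x y"
  unfolding rho_eq_suminf[OF assms] rho_eq_suminf[OF assms[THEN cube_proj_mem]]
  by (intro suminf_le rho_summable assms cube_proj_mem) (simp add: cube_proj_def)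

text \<open>The first \<open>k\<close> terms vanish and the remaining ones are dominated by a
  geometric series of sum \<open>1 / 2 ^ k\<close>.\<close>

lemma rho_cube_proj_self:
  assumes x: "x \<in> hilbert_cube"
  shows "rho x (cube_proj k x) \<le> 1 / 2 ^ k"
proof -
  let ?f = "\<lambda>i. \<bar>x i - cube_proj k x i\<bar> / 2 ^ Suc i"
  have s: "summable ?f" using rho_summable x cube_proj_mem by blast
  have g: "(\<lambda>i. (1/2) ^ k * (1/2::real) ^ Suc i) sums ((1/2) ^ k * 1)"
    by (intro sums_mult power_half_series)
  have "(\<Sum>i<k. ?f i) = 0" by (simp add: cube_proj_def)
  moreover have "(\<Sum>i. ?f (i + k)) \<le> (\<Sum>i. (1/2) ^ k * (1/2) ^ Suc i)"
  proof (intro suminf_le)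
    show "?f (i + k) \<le> (1/2) ^ k * (1/2) ^ Suc i" for i
      using rho_term_le[OF x cube_proj_mem[OF x], of "i + k" k] by (simp add: power_add mult_ac)
    show "summable (\<lambda>i. ?f (i + k))" using s by (rule summable_ignore_initial_segment)
  qed (use g sums_summable in blast)
  ultimately show ?thesis
    using suminf_split_initial_segment[OF s, of k] g[THEN sums_unique]
    unfolding rho_eq_suminf[OF x cube_proj_mem[OF x]] by (simp add: power_one_over)
qed

lemma segment_in_hilbert_cube:
  assumes "x \<in> hilbert_cube" "y \<in> hilbert_cube" "0 \<le> t" "t \<le> 1"
  shows "(\<lambda>i. x i + t * (y i - x i)) \<in> hilbert_cube"
proof -
  have "0 \<le> x i + t * (y i - x i) \<and> x i + t * (y i - x i) \<le> 1" for i
  proof -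
    have *: "0 \<le> x i" "x i \<le> 1" "0 \<le> y i" "y i \<le> 1"
      using assms by (auto simp: hilbert_cube_def)
    have "x i + t * (y i - x i) = (1 - t) * x i + t * y i" by (simp add: algebra_simps)
    moreover have "0 \<le> (1 - t) * x i + t * y i" using * assms by simp
    moreover have "(1 - t) * x i + t * y i \<le> 1"
      using * assms by (intro convex_bound_le) auto
    ultimately show ?thesis by simp
  qed
  then show ?thesis by (simp add: hilbert_cube_def)
qed

lemma rho_segment:
  assumes "0 \<le> t"
  shows "rho x (\<lambda>i. x i + t * (y i - x i)) = t * rho x y"
proof -
  have "\<bar>x i - (x i + t * (y i - x i))\<bar> / 2 ^ Suc i = t * (\<bar>x i - y i\<bar> / 2 ^ Suc i)" for i
    using assms abs_minus_commute[of "x i" "y i"] by (simp add: abs_mult)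
  then show ?thesis
    unfolding rho_def by (simp only: infsum_cmult_right')
qed

text \<open>Shrinking \<open>w\<close> towards \<open>u\<close> scales both distances, as \<^term>\<open>cube_proj k\<close> is linear; this turns
  the strict inequality in hypothesis (i) into one usable on closed balls.\<close>

lemma rho_cube_proj_modulus_closed:
  assumes mod: "\<And>u w. u \<in> hilbert_cube \<Longrightarrow> w \<in> hilbert_cube \<Longrightarrow> rho u w < e \<Longrightarrow>
      rho (cube_proj k u) (cube_proj k w) < d"
    and "e > 0" and u: "u \<in> hilbert_cube" and w: "w \<in> hilbert_cube" and le: "rho u w \<le> e"
  shows "rho (cube_proj k u) (cube_proj k w) \<le> d"
proof (rule field_le_mult_one_interval)
  fix t :: real assume t: "0 < t" "t < 1"
  let ?wt = "\<lambda>i. u i + t * (w i - u i)"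
  have "t * rho u w \<le> t * e" using le t by (intro mult_left_mono) auto
  also have "t * e < e" using t \<open>e > 0\<close> by simp
  finally have "t * rho u w < e" .
  then have "rho (cube_proj k u) (cube_proj k ?wt) < d"
    using t u w by (intro mod segment_in_hilbert_cube) (auto simp: rho_segment)
  moreover have "cube_proj k ?wt = (\<lambda>i. cube_proj k u i + t * (cube_proj k w i - cube_proj k u i))"
    by (auto simp: cube_proj_def)
  ultimately show "t * rho (cube_proj k u) (cube_proj k w) \<le> d"
    using t by (simp add: rho_segment)
qed

lemma rho_le_mesh:
  assumes "finite T" "\<sigma> \<in> T" "polyhedron_of T \<subseteq> hilbert_cube"
    and "x \<in> convex hull \<sigma>" "y \<in> convex hull \<sigma>"
  shows "rho x y \<le> mesh T"
proof -
  have sub: "convex hull \<sigma> \<subseteq> hilbert_cube"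
    using assms unfolding polyhedron_of_def by blast
  \<comment> \<open>The real \<open>SUP\<close> in \<open>rho_diameter\<close> is an upper bound
    only for a bounded family; this bound supplies that.\<close>
  have le1: "rho a b \<le> 1" if "a \<in> hilbert_cube" "b \<in> hilbert_cube" for a b
  proof -
    have "rho a b \<le> (\<Sum>i. (1/2) ^ Suc i)"
      unfolding rho_eq_suminf[OF that]
      using power_half_series sums_summable
      by (intro suminf_le rho_summable rho_term_le that) blast
    then show ?thesis using power_half_series[THEN sums_unique] by simp
  qed
  have "rho x y = (\<lambda>(x, y). rho x y) (x, y)" by simp
  also have "\<dots> \<le> rho_diameter (convex hull \<sigma>)"
    unfolding rho_diameter_def
  proof (rule cSUP_upper)
    show "bdd_above ((\<lambda>(x, y). rho x y) ` ((convex hull \<sigma>) \<times> (convex hull \<sigma>)))"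
      using le1 sub by (intro bdd_aboveI[of _ 1]) auto
  qed (use assms in auto)
  also have "\<dots> \<le> mesh T"
    unfolding mesh_def using assms by (intro Max_ge) auto
  finally show ?thesis .
qed

section \<open>Comparison of inverse limits and uniform limits of maps\<close>

lemma inverse_limit_subset:
  assumes "\<And>i. A i \<subseteq> B i"
  shows "inverse_limit A h \<subseteq> inverse_limit B h"
  using assms by (auto simp: inverse_limit_def)

text \<open>Each coordinate of a thread is the image of the next one, so it already lies in the
  smaller set.\<close>

lemma inverse_limit_interleaved:
  assumes "\<And>i. A i \<subseteq> B i" "\<And>i. h i ` B (Suc i) \<subseteq> A i"
  shows "inverse_limit B h = inverse_limit A h"
proof
  show "inverse_limit B h \<subseteq> inverse_limit A h"
  proof
    fix w assume "w \<in> inverse_limit B h"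
    then have w: "w i \<in> B i" "h i (w (Suc i)) = w i" for i
      by (simp_all add: inverse_limit_def)
    then have "w i \<in> A i" for i
      using assms(2)[of i] image_eqI[of "w i" "h i" "w (Suc i)" "B (Suc i)"] by auto
    with w(2) show "w \<in> inverse_limit A h"
      by (simp add: inverse_limit_def)
  qed
qed (use assms(1) in \<open>rule inverse_limit_subset\<close>)

lemma inverse_sequence_of_compactaI:
  fixes A :: "nat \<Rightarrow> 'a::metric_space set"
  assumes "\<And>i. compact (A i)" "\<And>i. is_map (A (Suc i)) (A i) (h i)"
  shows "inverse_sequence_of_compacta A h"
  using assms
  by (auto simp: inverse_sequence_of_compacta_def metrizable_compactum_def compact_space_subtopology
      metrizable_space_euclidean intro!: metrizable_space_subtopology)

text \<open>Coordinate \<open>k\<close> varies by at most \<open>2 ^ Suc k\<close> times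
  \<open>rho\<close>, so uniform \<open>rho\<close>-convergence is uniform in each coordinate, and
  continuity into the product is coordinatewise.\<close>

lemma continuous_on_coordinates_rho_limit:
  fixes W :: "nat \<Rightarrow> 'a::topological_space \<Rightarrow> nat \<Rightarrow> real"
  assumes cont: "\<And>i. is_map S hilbert_cube (W i)" and p: "p \<in> S \<rightarrow> hilbert_cube"
    and unif: "\<And>e. e > 0 \<Longrightarrow> \<exists>m. \<forall>i\<ge>m. \<forall>w\<in>S. rho (W i w) (p w) < e"
  shows "continuous_on S p"
proof (rule continuous_on_coordinatewise_then_product)
  fix k
  show "continuous_on S (\<lambda>w. p w k)"
  proof (rule uniform_limit_theorem)
    show "\<forall>\<^sub>F i in sequentially. continuous_on S (\<lambda>w. W i w k)"
      by (intro always_eventually allI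
          continuous_on_product_then_coordinatewise[OF conjunct1[OF cont]])
    show "uniform_limit S (\<lambda>i w. W i w k) (\<lambda>w. p w k) sequentially"
    proof (rule uniform_limitI)
      fix e :: real assume "e > 0"
      then have "e / 2 ^ Suc k > 0" by simp
      from unif[OF this] obtain m
        where m: "\<And>i w. i \<ge> m \<Longrightarrow> w \<in> S \<Longrightarrow> rho (W i w) (p w) < e / 2 ^ Suc k"
        by blast
      have "dist (W i w k) (p w k) < e" if "i \<ge> m" "w \<in> S" for i w
      proof -
        have "W i w \<in> hilbert_cube" "p w \<in> hilbert_cube"
          using cont[of i] p that by auto
        then have "\<bar>W i w k - p w k\<bar> / 2 ^ Suc k \<le> rho (W i w) (p w)"
          by (rule rho_ge_term)
        also have "\<dots> < e / 2 ^ Suc k" by (rule m[OF that])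
        finally show ?thesis by (simp add: divide_less_cancel dist_real_def)
      qed
      then show "\<forall>\<^sub>F i in sequentially. \<forall>w\<in>S. dist (W i w k) (p w k) < e"
        unfolding eventually_sequentially by blast
    qed
  qed simp
qed

section \<open>The adjusted sequence: its bonding maps are close to projections\<close>

locale adjusted_sequence = induced_inverse_sequence X K \<B> \<H> \<F> \<eta> n P \<epsilon> T' f \<delta> T \<phi> g D N F v
  for X :: "(nat \<Rightarrow> real) set"
    and K :: "('k \<Rightarrow> real) set set"
    and \<B> and \<H> :: "(nat \<Rightarrow> real) set \<Rightarrow> ('u \<Rightarrow> real) set \<Rightarrow> ((nat \<Rightarrow> real) \<Rightarrow> ('u \<Rightarrow> real)) set"
    and \<F> \<eta> n P \<epsilon> T' f \<delta> T \<phi> g D N F v +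
  fixes M :: "nat \<Rightarrow> (nat \<Rightarrow> real) set"
    and J :: "nat \<Rightarrow> nat"
    and h :: "nat \<Rightarrow> (nat \<Rightarrow> real) \<Rightarrow> (nat \<Rightarrow> real)"
  assumes M: "\<And>j. closed (M j)" "\<And>j. M j \<subseteq> polyhedron_of (T j)"
    and J: "strict_mono J"
    and h: "adjustment T g M J h"
begin

abbreviation LM where "LM \<equiv> inverse_limit (\<lambda>i. M (J i)) h"
abbreviation B where "B \<equiv> B_set n \<delta> M"
abbreviation B\<^sub>p where "B\<^sub>p \<equiv> B_plus v T' M"
abbreviation B\<^sub>s where "B\<^sub>s \<equiv> B_sharp n \<epsilon> M"

lemma complexes:
  "simplicial_complex (T j)" "finite (T j)" "polyhedron_of (T j) = P j"
  "simplicial_complex (T' j)" "finite (T' j)"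
  using triangulations[of j] by (auto simp: triangulation_of_def)

lemma P_cube: "P j \<subseteq> hilbert_cube"
  using P(2) finite_cube_subset by blast

lemma compact_P: "compact (P j)"
  using compact_polyhedron_of[OF complexes(1,2), of j] complexes(3) by simp

lemma M_P: "M j \<subseteq> P j"
  using M(2) complexes(3) by simp

lemma M_cube: "x \<in> M j \<Longrightarrow> x \<in> hilbert_cube"
  using M_P P_cube by blast

lemma compact_M: "compact (M j)"
  using compact_Int_closed[OF compact_P M(1), of j j] M_P[of j] by (simp add: Int_absorb1)

lemma X_cube: "x \<in> X \<Longrightarrow> x \<in> hilbert_cube"
  using X by blast

lemma J_less: "J i < J (Suc i)"
  using J by (simp add: strict_mono_Suc_iff)

lemma n_less: "n (J i) < n (J (Suc i))"
  using J_less n(1) by (simp add: strict_mono_def)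

lemma le_n_J: "i \<le> n (J i)"
  using seq_suble[OF J, of i] seq_suble[OF n(1), of "J i"] by linarith

text \<open>For \<open>s < j\<close> this is contained in (viii), since a modification requires both
  functions to map into the polyhedron; on \<open>P j\<close> itself the projection is the
  identity.\<close>

lemma cube_proj_P:
  assumes "s \<le> j" "x \<in> P j"
  shows "cube_proj (n s) x \<in> P s"
proof (cases "s = j")
  case True
  then have "cube_proj (n s) x = x"
    using assms P(2)[of j] by (force simp: cube_proj_def finite_cube_def)
  with True assms show ?thesis by simp
next
  case False
  then have "T_modification (P j) (T s) (cube_proj (n s)) (bonding g s j)"
    using viii[of s j] assms by (simp add: simplicial_approximation_def complexes)
  then show ?thesis using assms by (auto simp: T_modification_def complexes)
qed

text \<open>Some simplex contains \<open>p x\<close>, hence also \<open>q x\<close>, and (iv) bounds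
  its diameter.\<close>

lemma T_modification_close:
  assumes "T_modification Y (T j) p q" "x \<in> Y"
  shows "rho (p x) (q x) < \<delta> j / 2" "p x \<in> hilbert_cube" "q x \<in> hilbert_cube"
proof -
  have px: "p x \<in> P j" "q x \<in> P j"
    using assms by (auto simp: T_modification_def complexes)
  then show "p x \<in> hilbert_cube" "q x \<in> hilbert_cube"
    using P_cube by auto
  obtain \<sigma> where \<sigma>: "\<sigma> \<in> T j" "p x \<in> convex hull \<sigma>"
    using px complexes(3)[of j] by (auto simp: polyhedron_of_def)
  moreover have "q x \<in> convex hull \<sigma>"
    using assms \<sigma> by (auto simp: T_modification_def)
  ultimately have "rho (p x) (q x) \<le> mesh (T j)"
    using complexes P_cube by (intro rho_le_mesh) auto
  then show "rho (p x) (q x) < \<delta> j / 2" using iv[of j] by simp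
qed

lemma h_map: "is_map (M (J (Suc i))) (M (J i)) (h i)"
  using h by (auto simp: adjustment_def)

text \<open>Two errors of \<open>\<delta> (J i) / 2\<close> add up: from the projection to its
  simplicial approximation (viii), and from there to the modification \<open>h i\<close>.\<close>

lemma h_close:
  assumes x: "x \<in> M (J (Suc i))"
  shows "rho (cube_proj (n (J i)) x) (h i x) < \<delta> (J i)"
proof -
  let ?b = "bonding g (J i) (J (Suc i))"
  have 1: "T_modification (P (J (Suc i))) (T (J i)) (cube_proj (n (J i))) ?b"
    using viii[OF J_less[of i]] by (simp add: simplicial_approximation_def complexes)
  have 2: "T_modification (M (J (Suc i))) (T (J i)) ?b (h i)"
    using h by (auto simp: adjustment_def)
  have xP: "x \<in> P (J (Suc i))" using x M_P by blast
  show ?thesis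
    using T_modification_close[OF 1 xP] T_modification_close[OF 2 x]
      Hilbert.triangle[of "cube_proj (n (J i)) x" "?b x" "h i x"] by linarith
qed

section \<open>Convergence of threads\<close>

lemma LM_mem: "w \<in> LM \<Longrightarrow> w i \<in> M (J i)"
  and LM_bond: "w \<in> LM \<Longrightarrow> h i (w (Suc i)) = w i"
  by (auto simp: inverse_limit_def)

lemma LM_cube: "w \<in> LM \<Longrightarrow> w i \<in> hilbert_cube"
  using LM_mem M_cube by blast

lemma LM_proj_close: "w \<in> LM \<Longrightarrow> rho (cube_proj (n (J i)) (w (Suc i))) (w i) < \<delta> (J i)"
  using h_close[OF LM_mem, of w i] LM_bond[of w i] by simp

text \<open>The constant is 2 + 1: less than \<open>2 / 2 ^ n (J i)\<close> by (iii), and at most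
  \<open>1 / 2 ^ n (J i)\<close> for dropping coordinates.\<close>

lemma LM_step:
  assumes w: "w \<in> LM"
  shows "rho (w i) (w (Suc i)) \<le> 3 / 2 ^ n (J i)"
proof -
  let ?p = "cube_proj (n (J i)) (w (Suc i))"
  have "rho (w i) (w (Suc i)) \<le> rho ?p (w i) + rho (w (Suc i)) ?p"
    using Hilbert.triangle[of "w i" ?p "w (Suc i)"] LM_cube[OF w] cube_proj_mem
      Hilbert.commute by metis
  moreover have "3 / 2 ^ n (J i) = 2 / 2 ^ n (J i) + 1 / (2::real) ^ n (J i)"
    by (simp flip: add_divide_distrib)
  ultimately show ?thesis
    using LM_proj_close[OF w, of i] iii[of "J i"]
      rho_cube_proj_self[OF LM_cube[OF w], of "Suc i" "n (J i)"] by linarith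
qed

lemma divide_power_n_Suc_le: "c / 2 ^ n (J (Suc i)) \<le> c / 2 / 2 ^ n (J i)" if "c \<ge> 0" for c :: real
proof -
  have "(2::real) ^ Suc (n (J i)) \<le> 2 ^ n (J (Suc i))"
    using n_less[of i] by (intro power_increasing) auto
  then have "c / 2 ^ n (J (Suc i)) \<le> c / 2 ^ Suc (n (J i))"
    using that by (intro divide_left_mono) auto
  then show ?thesis by simp
qed

text \<open>The constant 6 reproduces itself: one step costs 3, and the bound 6 from the next stage
  is worth 3 here, as the exponent grows by at least one.\<close>

lemma LM_tail:
  assumes w: "w \<in> LM"
  shows "rho (w i) (w (i + d)) \<le> 6 / 2 ^ n (J i)"
proof (induction d arbitrary: i)
  case 0
  then show ?case using LM_cube[OF w] by simp
next
  case (Suc d)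
  have "rho (w i) (w (i + Suc d)) \<le> rho (w i) (w (Suc i)) + rho (w (Suc i)) (w (i + Suc d))"
    using Hilbert.triangle LM_cube[OF w] by blast
  also have "rho (w (Suc i)) (w (i + Suc d)) \<le> 3 / 2 ^ n (J i)"
    using Suc[of "Suc i"] divide_power_n_Suc_le[of 6 i] by simp
  also have "rho (w i) (w (Suc i)) \<le> 3 / 2 ^ n (J i)" by (rule LM_step[OF w])
  finally show ?case by simp
qed

lemma power_n_small:
  assumes "c \<ge> 0" "e > 0"
  shows "\<exists>m. \<forall>i\<ge>m. c / 2 ^ n (J i) < (e::real)"
proof -
  have "(\<lambda>i. c * (1/2::real) ^ i) \<longlonglongrightarrow> c * 0"
    by (intro tendsto_mult_left LIMSEQ_power_zero) auto
  then obtain m where m: "\<And>i. i \<ge> m \<Longrightarrow> c * (1/2) ^ i < e"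
    using order_tendstoD(2)[of "\<lambda>i. c * (1/2::real) ^ i" 0 sequentially e] assms(2)
    by (auto simp: eventually_sequentially)
  have "c / 2 ^ n (J i) \<le> c * (1/2) ^ i" for i
    using le_n_J[of i] assms by (simp add: power_one_over field_simps mult_left_mono)
  then show ?thesis using m by (meson le_less_trans)
qed

lemma LM_uniformly_Cauchy:
  assumes "e > 0"
  shows "\<exists>m. \<forall>i\<ge>m. \<forall>k\<ge>m. \<forall>w\<in>LM. rho (w i) (w k) < e"
proof -
  obtain m where m: "\<And>i. i \<ge> m \<Longrightarrow> 6 / 2 ^ n (J i) < e"
    using power_n_small[of 6 e] assms by auto
  have 1: "rho (w i) (w k) < e" if "m \<le> i" "i \<le> k" "w \<in> LM" for i k w
    using LM_tail[OF that(3), of i "k - i"] m[OF that(1)] that(2) by simp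
  have "rho (w i) (w k) < e" if "m \<le> i" "m \<le> k" "w \<in> LM" for i k w
    using 1[of i k w] 1[of k i w] that Hilbert.commute[of "w i" "w k"]
    by (cases "i \<le> k") auto
  then show ?thesis by blast
qed

lemma LM_MCauchy: "w \<in> LM \<Longrightarrow> Hilbert.MCauchy w"
  unfolding Hilbert.MCauchy_def using LM_cube LM_uniformly_Cauchy by (meson image_subsetI)

text \<open>For fixed \<open>j\<close> all late terms project into the closed set
  \<open>P j\<close>, hence so does the limit; \<open>X_exhausts\<close> concludes.\<close>

lemma limit_in_X:
  assumes w: "w \<in> LM" and lim: "limitin Hilbert.mtopology w a sequentially"
  shows "a \<in> X"
proof -
  have a: "a \<in> hilbert_cube" "w \<longlonglongrightarrow> a" using lim by (auto simp: limitin_rho_iff)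
  have "cube_proj (n j) a \<in> P j" for j
  proof (rule closed_sequentially[OF compact_imp_closed[OF compact_P]])
    show "(\<lambda>i. cube_proj (n j) (w (i + j))) \<longlonglongrightarrow> cube_proj (n j) a"
      by (rule continuous_on_tendsto_compose[OF continuous_on_cube_proj[of UNIV]
            LIMSEQ_ignore_initial_segment[OF a(2)]]) auto
    \<comment> \<open>The shift by \<open>j\<close> ensures that the stage \<open>J (i + j)\<close>
      is at least \<open>j\<close>.\<close>
    have "w (i + j) \<in> P (J (i + j))" "j \<le> J (i + j)" for i
      using LM_mem[OF w] M_P seq_suble[OF J, of "i + j"] by (blast, linarith)
    then show "cube_proj (n j) (w (i + j)) \<in> P j" for i
      using cube_proj_P by blast
  qed
  then show ?thesis using X_exhausts a by blast
qed

lemma limit_exists: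
  assumes w: "w \<in> LM"
  shows "\<exists>a\<in>X. limitin Hilbert.mtopology w a sequentially"
proof -
  have "compact_space Hilbert.mtopology"
    using compact_hilbert_cube by (simp add: mtopology_rho compact_space_subtopology)
  then have "Hilbert.mcomplete" by (rule Hilbert.compact_space_imp_mcomplete)
  then show ?thesis
    using LM_MCauchy[OF w] limit_in_X[OF w] unfolding Hilbert.mcomplete_def by blast
qed

lemma limit_point_of_unique:
  assumes "limitin Hilbert.mtopology w a sequentially"
  shows "limit_point_of w = a"
  unfolding limit_point_of_def
  using assms by (intro the_equality) (auto intro: Hilbert.limitin_metric_unique)

lemma limit_point:
  assumes w: "w \<in> LM"
  shows "limitin Hilbert.mtopology w (limit_point_of w) sequentially"
    and "limit_point_of w \<in> X"
  using limit_exists[OF w] limit_point_of_unique by auto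

text \<open>The bound of \<open>LM_tail\<close> describes a closed ball about \<open>w i\<close>, so
  it survives the passage to the limit.\<close>

lemma rho_limit_point:
  assumes w: "w \<in> LM"
  shows "rho (w i) (limit_point_of w) \<le> 6 / 2 ^ n (J i)"
proof -
  let ?a = "limit_point_of w"
  have lim: "(\<lambda>d. w (d + i)) \<longlonglongrightarrow> ?a"
    using limit_point(1)[OF w] by (intro LIMSEQ_ignore_initial_segment) (simp add: limitin_rho_iff)
  have "w (d + i) \<in> Hilbert.mcball (w i) (6 / 2 ^ n (J i))" for d
    using LM_tail[OF w, of i d] LM_cube[OF w] by (simp add: add.commute)
  then have "?a \<in> Hilbert.mcball (w i) (6 / 2 ^ n (J i))"
    by (rule closed_sequentially[OF closed_Hilbert_mcball _ lim])
  then show ?thesis by simp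
qed

lemma limit_uniform:
  assumes "e > 0"
  shows "\<exists>m. \<forall>i\<ge>m. \<forall>w\<in>LM. rho (w i) (limit_point_of w) < e"
  using power_n_small[of 6 e] assms rho_limit_point by (meson le_less_trans zero_le_numeral)

lemma LM_coordinate_map: "is_map LM hilbert_cube (\<lambda>w. w i)"
  using LM_cube by (blast intro: continuous_on_subset[OF continuous_on_product_coordinates])

lemma limit_point_of_map: "is_map LM hilbert_cube limit_point_of"
proof -
  have p: "limit_point_of \<in> LM \<rightarrow> hilbert_cube" using limit_point(2) X_cube by blast
  have "continuous_on LM limit_point_of"
    by (rule continuous_on_coordinates_rho_limit[OF LM_coordinate_map p limit_uniform])
  with p show ?thesis by blast
qed

section \<open>The sets around a point of \<open>X\<close> and their interleaving\<close>

lemma B_subset_B\<^sub>p: "x \<in> X \<Longrightarrow> B x j \<subseteq> B\<^sub>p x j"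
  using vii[of x j] M_P[of j] unfolding B_set_def B_plus_def by blast

lemma B\<^sub>p_subset_B\<^sub>s: "x \<in> X \<Longrightarrow> B\<^sub>p x j \<subseteq> B\<^sub>s x j"
  using vii[of x j] unfolding B_sharp_def B_plus_def by blast

text \<open>Hypothesis (i) in its closed form, applied to \<open>cube_proj (n j) x\<close> and
  \<open>u\<close>; the two successive projections of \<open>x\<close> collapse because
  \<open>n s \<le> n j\<close>.\<close>

lemma cube_proj_modulus:
  assumes "s < j" "x \<in> hilbert_cube" "u \<in> hilbert_cube" "rho (cube_proj (n j) x) u \<le> \<epsilon> j"
  shows "rho (cube_proj (n s) x) (cube_proj (n s) u) \<le> \<delta> s"
proof -
  have "rho (cube_proj (n s) (cube_proj (n j) x)) (cube_proj (n s) u) \<le> \<delta> s"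
    by (rule rho_cube_proj_modulus_closed[where e = "\<epsilon> j"])
      (use assms pos i in \<open>auto intro: cube_proj_mem\<close>)
  moreover have "n s \<le> n j" using assms n(1) by (simp add: strict_mono_less_eq)
  ultimately show ?thesis by (simp add: cube_proj_cube_proj)
qed

text \<open>One \<open>\<delta> (J i)\<close> comes from (i) and one from \<open>h_close\<close>,
  which is why \<open>B\<close> has radius \<open>2 * \<delta>\<close>.\<close>

lemma h_image_B\<^sub>s:
  assumes x: "x \<in> X"
  shows "h i ` B\<^sub>s x (J (Suc i)) \<subseteq> B x (J i)"
proof (clarify)
  fix u assume u: "u \<in> B\<^sub>s x (J (Suc i))"
  then have uM: "u \<in> M (J (Suc i))" and le: "rho (cube_proj (n (J (Suc i))) x) u \<le> \<epsilon> (J (Suc i))"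
    by (auto simp: B_sharp_def)
  have uc: "u \<in> hilbert_cube" using uM M_cube by blast
  have hM: "h i u \<in> M (J i)" using h_map[of i] uM by blast
  have "rho (cube_proj (n (J i)) x) (h i u) \<le>
      rho (cube_proj (n (J i)) x) (cube_proj (n (J i)) u) + rho (cube_proj (n (J i)) u) (h i u)"
    using uc hM X_cube[OF x] cube_proj_mem M_cube by (intro Hilbert.triangle) auto
  also have "\<dots> \<le> 2 * \<delta> (J i)"
    using cube_proj_modulus[OF J_less X_cube[OF x] uc le] h_close[OF uM] by simp
  finally show "h i u \<in> B x (J i)"
    using hM x X_cube M_cube cube_proj_mem by (auto simp: B_set_def)
qed

lemma compact_B: "compact (B x j)" and compact_B\<^sub>p: "compact (B\<^sub>p x j)"
  and compact_B\<^sub>s: "compact (B\<^sub>s x j)"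
  unfolding B_set_def B_plus_def B_sharp_def
  by (auto intro!: closed_Int_compact closed_Hilbert_mcball compact_M
      compact_imp_closed compact_closed_star complexes)

lemma inverse_sequenceI:
  assumes "\<And>i. A i \<subseteq> M (J i)" "\<And>i. compact (A i)" "\<And>i. h i ` A (Suc i) \<subseteq> A i"
  shows "inverse_sequence_of_compacta A h"
proof (rule inverse_sequence_of_compactaI)
  show "is_map (A (Suc i)) (A i) (h i)" for i
    using continuous_on_subset[OF conjunct1[OF h_map] assms(1)] assms(3)[of i]
    by (simp add: image_subset_iff_funcset)
qed (rule assms)

lemma h_images:
  assumes x: "x \<in> X"
  shows "h i ` B x (J (Suc i)) \<subseteq> B x (J i)" "h i ` B\<^sub>p x (J (Suc i)) \<subseteq> B\<^sub>p x (J i)"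
    "h i ` B\<^sub>s x (J (Suc i)) \<subseteq> B\<^sub>s x (J i)" "h i ` B\<^sub>p x (J (Suc i)) \<subseteq> B x (J i)"
  using h_image_B\<^sub>s[OF x, of i] B_subset_B\<^sub>p[OF x, of "J i"] B\<^sub>p_subset_B\<^sub>s[OF x, of "J i"]
    image_mono[OF B_subset_B\<^sub>p[OF x, of "J (Suc i)"], of "h i"]
    image_mono[OF B\<^sub>p_subset_B\<^sub>s[OF x, of "J (Suc i)"], of "h i"]
  by simp_all

lemma inverse_sequences:
  assumes x: "x \<in> X"
  shows "inverse_sequence_of_compacta (\<lambda>i. B x (J i)) h"
    "inverse_sequence_of_compacta (\<lambda>i. B\<^sub>p x (J i)) h"
    "inverse_sequence_of_compacta (\<lambda>i. B\<^sub>s x (J i)) h"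
proof -
  show "inverse_sequence_of_compacta (\<lambda>i. B x (J i)) h"
    by (rule inverse_sequenceI[OF _ compact_B h_images(1)[OF x]]) (simp add: B_set_def)
  show "inverse_sequence_of_compacta (\<lambda>i. B\<^sub>p x (J i)) h"
    by (rule inverse_sequenceI[OF _ compact_B\<^sub>p h_images(2)[OF x]]) (simp add: B_plus_def)
  show "inverse_sequence_of_compacta (\<lambda>i. B\<^sub>s x (J i)) h"
    by (rule inverse_sequenceI[OF _ compact_B\<^sub>s h_images(3)[OF x]]) (simp add: B_sharp_def)
qed

lemma inverse_limits_eq:
  assumes x: "x \<in> X"
  shows "inverse_limit (\<lambda>i. B\<^sub>p x (J i)) h = inverse_limit (\<lambda>i. B x (J i)) h"
    "inverse_limit (\<lambda>i. B\<^sub>s x (J i)) h = inverse_limit (\<lambda>i. B x (J i)) h"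
proof -
  show "inverse_limit (\<lambda>i. B\<^sub>p x (J i)) h = inverse_limit (\<lambda>i. B x (J i)) h"
    by (intro inverse_limit_interleaved B_subset_B\<^sub>p h_images(4) x)
  show "inverse_limit (\<lambda>i. B\<^sub>s x (J i)) h = inverse_limit (\<lambda>i. B x (J i)) h"
    by (intro inverse_limit_interleaved h_image_B\<^sub>s x
        subset_trans[OF B_subset_B\<^sub>p B\<^sub>p_subset_B\<^sub>s])
qed

section \<open>Fibres of the limit map and surjectivity\<close>

text \<open>Comparing at stage \<open>Suc i\<close> and projecting costs 3, and
  \<open>LM_proj_close\<close> with (iii) costs 2, in units of \<open>1 / 2 ^ n (J i)\<close>; the
  total 5 is what (ii) places below \<open>\<epsilon>\<close>.\<close>

lemma fibre_subset:
  assumes w: "w \<in> LM" and x: "limit_point_of w = x"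
  shows "w \<in> inverse_limit (\<lambda>i. B\<^sub>s x (J i)) h"
proof -
  have xc: "x \<in> hilbert_cube" using limit_point(2)[OF w] x X_cube by blast
  have "rho (cube_proj (n (J i)) x) (w i) \<le> \<epsilon> (J i)" for i
  proof -
    let ?p = "cube_proj (n (J i))"
    have "rho (?p x) (w i) \<le> rho (?p x) (?p (w (Suc i))) + rho (?p (w (Suc i))) (w i)"
      using xc LM_cube[OF w] cube_proj_mem by (intro Hilbert.triangle) auto
    also have "rho (?p x) (?p (w (Suc i))) \<le> rho x (w (Suc i))"
      using rho_cube_proj_le xc LM_cube[OF w] by blast
    also have "rho x (w (Suc i)) \<le> 3 / 2 ^ n (J i)"
      using rho_limit_point[OF w, of "Suc i"] divide_power_n_Suc_le[of 6 i] x Hilbert.commute[of x "w (Suc i)"]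
      by simp
    also have "rho (?p (w (Suc i))) (w i) \<le> 2 / 2 ^ n (J i)"
      using LM_proj_close[OF w, of i] iii[of "J i"] by simp
    finally show ?thesis using ii[of "J i"] by simp
  qed
  then show ?thesis
    using w xc LM_cube[OF w] cube_proj_mem by (auto simp: inverse_limit_def B_sharp_def)
qed

text \<open>By (iii) the radius \<open>2 * \<delta>\<close> is below \<open>4 / 2 ^ n (J i)\<close>;
  with the projection error the distance to \<open>x\<close> is at most
  \<open>5 / 2 ^ n (J i)\<close>, which tends to 0.\<close>

lemma fibre_supset:
  assumes x: "x \<in> X" and w: "w \<in> inverse_limit (\<lambda>i. B x (J i)) h"
  shows "w \<in> LM" "limit_point_of w = x"
proof -
  show wL: "w \<in> LM"
    using w by (auto simp: inverse_limit_def B_set_def)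
  have xc: "x \<in> hilbert_cube" using x X_cube by blast
  have est: "rho (w i) x \<le> 5 / 2 ^ n (J i)" for i
  proof -
    have "w i \<in> B x (J i)" using w by (auto simp: inverse_limit_def)
    then have "rho (cube_proj (n (J i)) x) (w i) \<le> 2 * \<delta> (J i)" by (simp add: B_set_def)
    moreover have "rho x (w i) \<le> rho x (cube_proj (n (J i)) x) + rho (cube_proj (n (J i)) x) (w i)"
      using xc LM_cube[OF wL] cube_proj_mem by (intro Hilbert.triangle) auto
    moreover have "5 / 2 ^ n (J i) = 1 / (2::real) ^ n (J i) + 2 * (2 / 2 ^ n (J i))"
      by (simp flip: add_divide_distrib)
    ultimately show ?thesis
      using rho_cube_proj_self[OF xc, of "n (J i)"] iii[of "J i"] Hilbert.commute[of x "w i"]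
      by linarith
  qed
  have "limitin Hilbert.mtopology w x sequentially"
    unfolding Hilbert.limit_metric_sequentially
    using xc LM_cube[OF wL] est power_n_small[of 5] by (meson le_less_trans zero_le_numeral)
  then show "limit_point_of w = x" by (rule limit_point_of_unique)
qed

text \<open>Points of the fibre are only seen to lie in the limit of the largest sets
  \<open>B\<^sub>s\<close>; interleaving identifies it with that of the smallest.\<close>

lemma fibre:
  assumes x: "x \<in> X"
  shows "{w\<in>LM. limit_point_of w = x} = inverse_limit (\<lambda>i. B x (J i)) h"
  using fibre_subset fibre_supset[OF x] inverse_limits_eq(2)[OF x] by blast

text \<open>The points $p_{n_j,\infty}(x)$ are not known to lie in \<open>P j\<close>; the projection of the vertex
  \<open>v x (Suc j)\<close> lies there and serves as a substitute.\<close>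

lemma B_nonempty:
  assumes x: "x \<in> X" and vert: "vertices (T j) \<subseteq> M j"
  shows "B x j \<noteq> {}"
proof -
  let ?u = "v x (Suc j)"
  have xc: "x \<in> hilbert_cube" using x X_cube by blast
  have "{?u} \<in> T' (Suc j)" using vii[OF x, of "Suc j"] by (simp add: vertices_def)
  \<comment> \<open>A vertex lies in its own star, so (vii) puts \<open>?u\<close> in
    \<open>P (Suc j)\<close> and near the projection of \<open>x\<close>.\<close>
  then have "?u \<in> closed_star ?u (T' (Suc j))" by (force simp: closed_star_def hull_inc)
  then have u: "?u \<in> P (Suc j)" "rho (cube_proj (n (Suc j)) x) ?u \<le> \<epsilon> (Suc j)"
    using vii[OF x, of "Suc j"] by auto
  let ?q = "cube_proj (n j) ?u"
  have uc: "?u \<in> hilbert_cube" using u P_cube by blast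
  have close: "rho (cube_proj (n j) x) ?q \<le> \<delta> j"
    using cube_proj_modulus[of j "Suc j"] xc uc u(2) by simp
  have "?q \<in> polyhedron_of (T j)" using cube_proj_P[of j "Suc j"] u complexes by simp
  then obtain \<sigma> where \<sigma>: "\<sigma> \<in> T j" "?q \<in> convex hull \<sigma>" by (auto simp: polyhedron_of_def)
  \<comment> \<open>Any vertex of the simplex containing \<open>?q\<close> lies in
    \<open>M j\<close> by \<open>vert\<close>, and is within \<open>\<delta> j / 2\<close> of
    \<open>?q\<close> by (iv).\<close>
  then obtain y where y: "y \<in> \<sigma>" and yT: "{y} \<in> T j"
    using complexes(1)[of j] unfolding simplicial_complex_def
    by (metis empty_not_insert empty_subsetI ex_in_conv insert_subset)
  have yM: "y \<in> M j" using yT vert by (auto simp: vertices_def)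
  have "rho ?q y \<le> mesh (T j)"
    using \<sigma> y complexes P_cube by (intro rho_le_mesh[of _ \<sigma>]) (auto simp: hull_inc)
  moreover have "rho (cube_proj (n j) x) y \<le> rho (cube_proj (n j) x) ?q + rho ?q y"
    using xc uc yM M_cube cube_proj_mem by (intro Hilbert.triangle) auto
  ultimately have "rho (cube_proj (n j) x) y \<le> 2 * \<delta> j"
    using close iv[of j] pos(2)[of j] by linarith
  then have "y \<in> B x j"
    using yM xc M_cube cube_proj_mem by (auto simp: B_set_def)
  then show ?thesis by blast
qed

text \<open>The nonempty compacta \<open>B x (J i)\<close> have a thread, and every such thread
  converges to \<open>x\<close>.\<close>

lemma limit_point_of_surj:
  assumes vert: "\<And>i. vertices (T (J i)) \<subseteq> M (J i)"
  shows "limit_point_of ` LM = X"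
proof
  show "X \<subseteq> limit_point_of ` LM"
  proof
    fix x assume x: "x \<in> X"
    have "inverse_limit (\<lambda>i. B x (J i)) h \<noteq> {}"
      using inverse_sequences(1)[OF x] B_nonempty[OF x vert] compact_B
      unfolding inverse_sequence_of_compacta_def by (intro inverse_limit_nonempty) auto
    then obtain w where w: "w \<in> inverse_limit (\<lambda>i. B x (J i)) h" by blast
    show "x \<in> limit_point_of ` LM"
      using fibre_supset[OF x w] by (intro image_eqI[of _ _ w]) simp_all
  qed
qed (use limit_point(2) in blast)

end

theorem lemma7p8:
  fixes X :: "(nat \<Rightarrow> real) set"
    and K :: "('k \<Rightarrow> real) set set"
    and \<H> :: "(nat \<Rightarrow> real) set \<Rightarrow> ('u \<Rightarrow> real) set \<Rightarrow> ((nat \<Rightarrow> real) \<Rightarrow> ('u \<Rightarrow> real)) set"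
    and M :: "nat \<Rightarrow> (nat \<Rightarrow> real) set"
    and J :: "nat \<Rightarrow> nat"
    and h :: "nat \<Rightarrow> (nat \<Rightarrow> real) \<Rightarrow> (nat \<Rightarrow> real)"
    and LM :: "(nat \<Rightarrow> nat \<Rightarrow> real) set"
    and \<pi> :: "(nat \<Rightarrow> nat \<Rightarrow> real) \<Rightarrow> (nat \<Rightarrow> real)"
    and B B\<^sub>p B\<^sub>s :: "(nat \<Rightarrow> real) \<Rightarrow> nat \<Rightarrow> (nat \<Rightarrow> real) set"
  assumes "induced_inverse_sequence X K \<B> \<H> \<F> \<eta> n P \<epsilon> T' f \<delta> T \<phi> g D N F v"
    and "\<And>j. M j \<noteq> {} \<and> closed (M j) \<and> M j \<subseteq> polyhedron_of (T j)"
    and "\<And>j. g j ` M (Suc j) \<subseteq> M j"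
    and "strict_mono J"
    and "adjustment T g M J h"
    and LM: "LM = inverse_limit (\<lambda>i. M (J i)) h"
    and \<pi>: "\<pi> = limit_point_of"
    and B: "B = B_set n \<delta> M"
    and B\<^sub>p: "B\<^sub>p = B_plus v T' M"
    and B\<^sub>s: "B\<^sub>s = B_sharp n \<epsilon> M"
  shows
    \<comment> \<open>(1)\<close>
    "(\<forall>w\<in>LM. Hilbert.MCauchy w \<and> (\<exists>a\<in>X. limitin Hilbert.mtopology w a sequentially)) \<and>
    \<comment> \<open>(2)\<close>
     ((\<forall>i. is_map LM hilbert_cube (\<lambda>w. w i)) \<and>
      (\<forall>e>0. \<exists>m. \<forall>i\<ge>m. \<forall>k\<ge>m. \<forall>w\<in>LM. rho (w i) (w k) < e) \<and>
      (\<forall>e>0. \<exists>m. \<forall>i\<ge>m. \<forall>w\<in>LM. rho (w i) (\<pi> w) < e) \<and>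
      is_map LM hilbert_cube \<pi> \<and> \<pi> ` LM \<subseteq> X) \<and>
    \<comment> \<open>(3)\<close>
     (\<forall>x\<in>X. \<forall>i. B x (J i) \<subseteq> B\<^sub>p x (J i) \<and> B\<^sub>p x (J i) \<subseteq> B\<^sub>s x (J i) \<and>
        h i ` B\<^sub>s x (J (Suc i)) \<subseteq> B x (J i)) \<and>
    \<comment> \<open>(4)\<close>
     (\<forall>x\<in>X. inverse_sequence_of_compacta (\<lambda>i. B x (J i)) h \<and>
        inverse_sequence_of_compacta (\<lambda>i. B\<^sub>p x (J i)) h \<and>
        inverse_sequence_of_compacta (\<lambda>i. B\<^sub>s x (J i)) h) \<and>
    \<comment> \<open>(5)\<close>
     (\<forall>x\<in>X. inverse_limit (\<lambda>i. B x (J i)) h = inverse_limit (\<lambda>i. B\<^sub>p x (J i)) h \<and>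
        inverse_limit (\<lambda>i. B\<^sub>p x (J i)) h = inverse_limit (\<lambda>i. B\<^sub>s x (J i)) h) \<and>
    \<comment> \<open>(6)\<close>
     (\<forall>x\<in>X. {w\<in>LM. \<pi> w = x} = inverse_limit (\<lambda>i. B x (J i)) h) \<and>
    \<comment> \<open>(7)\<close>
     ((\<forall>i. vertices (T (J i)) \<subseteq> M (J i)) \<longrightarrow> \<pi> ` LM = X)"
proof -
  interpret adjusted_sequence X K \<B> \<H> \<F> \<eta> n P \<epsilon> T' f \<delta> T \<phi> g D N F v M J h
    using assms(1,2,4,5) by (auto simp: adjusted_sequence_def adjusted_sequence_axioms_def)
  have "\<pi> ` LM \<subseteq> X"
    using limit_point(2) unfolding LM \<pi> by blast
  then show ?thesis
    using limit_point_of_surj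
    unfolding LM \<pi> B B\<^sub>p B\<^sub>s
    by (intro conjI)
      (simp_all add: LM_MCauchy limit_exists LM_coordinate_map LM_uniformly_Cauchy limit_uniform
        limit_point_of_map B_subset_B\<^sub>p B\<^sub>p_subset_B\<^sub>s h_image_B\<^sub>s inverse_sequences
        inverse_limits_eq fibre)
qed

end
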